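(* Let $k\ge2$ and $\ell,m\ge0$ be integers. Then the set \[ \mathcal{A}_{\ell,m}^{(k)}:=\Big\{n\in\mathbb{Z}_{\ge1}\ \Big|\ \#\big((n^k,(n+1)^k)\cap\mathcal{S}_k\big)=\ell,\ \#\big(((n+1)^k,(n+2)^k)\cap\mathcal{S}_k\big)=m\Big\} \] has positive asymptotic density \[ d(\mathcal{A}_{\ell,m}^{(k)})=\sum_{\substack{\mathcal{I},\mathcal{J}\subseteq\Lambda_k\\ \#\mathcal{I}=\ell,\ \#\mathcal{J}=m,\ \mathcal{I}\cap\mathcal{J}=\varnothing}}\ \prod_{\lambda\in\mathcal{I}\cup\mathcal{J}}\frac{1}{\lambda}\cdot\prod_{\lambda\in\Lambda_k\setminus(\mathcal{I}\cup\mathcal{J})}\Big(1-\frac{2}{\lambda}\Big), \] i.e. $d(\mathcal{A}_{\ell,m}^{(k)})=\sum d(\mathcal{B}_{\mathcal{I},\mathcal{J}}^{(k)})$ over the same index set.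
   Context: Let $k\ge2$ be an integer. A positive integer $n$ is $k$-full if $p^k\mid n$ for every prime $p\mid n$. Let $\mathcal{S}_k$ be the set of $k$-full integers that are not perfect $k$th powers. Define \[ \Lambda_k:=\Big\{(b_1^{k+1}b_2^{k+2}\cdots b_{k-1}^{2k-1})^{1/k}\ \Big|\ b_1,\dots,b_{k-1}\in\mathbb{Z}_{\ge1},\ b_1\cdots b_{k-1}\ge2,\ b_1\cdots b_{k-1}\text{ squarefree}\Big\}. \] For nonempty $\mathcal{I}\subseteq\Lambda_k$ let $\mathcal{S}_{\mathcal{I}}:=\{a^k\lambda^k\mid a\in\mathbb{Z}_{\ge1},\lambda\in\mathcal{I}\}$, and $\mathcal{S}_\varnothing:=\varnothing$. For disjoint finite $\mathcal{I},\mathcal{J}\subseteq\Lambda_k$, $\mathcal{B}_{\mathcal{I},\mathcal{J}}^{(k)}$ is the set of $n\ge1$ with $\#((n^k,(n+1)^k)\cap\mathcal{S}_{\mathcal{I}})=\#\mathcal{I}$, $\#(((n+1)^k,(n+2)^k)\cap\mathcal{S}_{\mathcal{J}})=\#\mathcal{J}$ and $(n^k,(n+2)^k)\cap\mathcal{S}_{\Lambda_k\setminus(\mathcal{I}\cup\mathcal{J})}=\varnothing$. For $\mathcal{A}\subseteq\mathbb{Z}_{\ge1}$, $\#\mathcal{A}(x)$ counts its elements $\le x$ and $d(\mathcal{A}):=\lim_{x\to\infty}\#\mathcal{A}(x)/x$ when it exists. *)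

theory Defs
  imports "HOL-Analysis.Analysis" "HOL-Computational_Algebra.Squarefree"
begin

definition k_full :: "nat \<Rightarrow> nat \<Rightarrow> bool" where
  "k_full k n \<longleftrightarrow> n \<ge> 1 \<and> (\<forall>p. prime p \<and> p dvd n \<longrightarrow> p ^ k dvd n)"

definition S_set :: "nat \<Rightarrow> nat set" where
  "S_set k = {n. k_full k n \<and> \<not> (\<exists>a::nat. n = a ^ k)}"

definition Lambda_set :: "nat \<Rightarrow> real set" where
  "Lambda_set k = {root k (\<Prod>i\<in>{1..k-1}. real (b i) ^ (k + i)) | b :: nat \<Rightarrow> nat.
      (\<forall>i\<in>{1..k-1}. b i \<ge> 1) \<and> (\<Prod>i\<in>{1..k-1}. b i) \<ge> 2 \<and>
      squarefree (\<Prod>i\<in>{1..k-1}. b i)}"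

definition S_of :: "nat \<Rightarrow> real set \<Rightarrow> nat set" where
  "S_of k I = {n. \<exists>a::nat. a \<ge> 1 \<and> (\<exists>l\<in>I. real n = real a ^ k * l ^ k)}"

definition between :: "nat set \<Rightarrow> nat \<Rightarrow> nat \<Rightarrow> nat set" where
  "between A x y = {s\<in>A. x < s \<and> s < y}"

definition B_set :: "nat \<Rightarrow> real set \<Rightarrow> real set \<Rightarrow> nat set" where
  "B_set k I J = {n. n \<ge> 1 \<and>
      card (between (S_of k I) (n ^ k) ((n + 1) ^ k)) = card I \<and>
      card (between (S_of k J) ((n + 1) ^ k) ((n + 2) ^ k)) = card J \<and>
      between (S_of k (Lambda_set k - (I \<union> J))) (n ^ k) ((n + 2) ^ k) = {}}"

definition A_set :: "nat \<Rightarrow> nat \<Rightarrow> nat \<Rightarrow> nat set" where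
  "A_set k l m = {n. n \<ge> 1 \<and>
      card (between (S_set k) (n ^ k) ((n + 1) ^ k)) = l \<and>
      card (between (S_set k) ((n + 1) ^ k) ((n + 2) ^ k)) = m}"

definition has_density :: "nat set \<Rightarrow> real \<Rightarrow> bool" where
  "has_density A D \<longleftrightarrow> ((\<lambda>x::real. real (card {n\<in>A. real n \<le> x}) / x) \<longlongrightarrow> D) at_top"

definition set_prod_lim :: "(real \<Rightarrow> real) \<Rightarrow> real set \<Rightarrow> real" where
  "set_prod_lim f A = Lim at_top (\<lambda>N::real. \<Prod>x\<in>{x\<in>A. x \<le> N}. f x)"

definition dens_term :: "nat \<Rightarrow> real set \<Rightarrow> real set \<Rightarrow> real" where
  "dens_term k I J = (\<Prod>l\<in>I \<union> J. 1 / l) *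
      set_prod_lim (\<lambda>l. 1 - 2 / l) (Lambda_set k - (I \<union> J))"

definition index_set :: "nat \<Rightarrow> nat \<Rightarrow> nat \<Rightarrow> (real set \<times> real set) set" where
  "index_set k l m = {(I, J). I \<subseteq> Lambda_set k \<and> J \<subseteq> Lambda_set k \<and> finite I \<and> finite J \<and>
      card I = l \<and> card J = m \<and> I \<inter> J = {}}"

end

theory Submission
  imports Defs
    "HOL-Computational_Algebra.Fundamental_Theorem_Algebra"
    "HOL-Computational_Algebra.Field_as_Ring"
    "HOL-Computational_Algebra.Polynomial_Factorial"
    "HOL-Real_Asymp.Real_Asymp"
begin

text \<open>
  A number \<open>a^k \<lambda>^k\<close> lies in \<open>(n^k, (n+1)^k)\<close> iff \<open>n < a \<lambda> < n + 1\<close>, a condition on the fractional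
  part of \<open>n / \<lambda>\<close>. The numbers \<open>1\<close> and \<open>1 / \<lambda>\<close> are linearly independent over the rationals: dividing
  a relation by one of its radicals leaves a nonzero rational plus irrational positive radicals, and
  multiplication by such a radical has trace zero on a finite-dimensional rational space, whereas 1 does
  not. So by Weyl's criterion the events for finitely many \<open>\<lambda>\<close> are independent, with probabilities
  \<open>1 / \<lambda>\<close>, \<open>1 / \<lambda>\<close> and \<open>1 - 2 / \<lambda>\<close>. Since the sum of all \<open>1 / \<lambda>\<close> converges, the large \<open>\<lambda>\<close> affect only
  a set of small upper density.
\<close>

section \<open>Linear independence of real radicals\<close>

text \<open>Irrationality of the single numbers \<open>1 / \<lambda>\<close> would not give joint
  equidistribution; the Weyl sums need independence of 1 and all of them. After division the other
  radicals are irrational because each \<open>\<lambda> ^ k\<close> has all prime exponents 0 or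
  strictly between \<open>k\<close> and \<open>2 * k\<close>, so it is determined by its class
  modulo k-th powers of positive rationals. Trace zero is read off a basis of chains
  \<open>w, \<alpha> w, ..., \<alpha>^(d-1) w\<close>, with \<open>d\<close> least such that
  \<open>\<alpha>^d\<close> is rational: multiplication by \<alpha> sends each basis vector to a
  rational multiple of another one. Density is not countably additive, yet infinitely many \<lambda>
  enter each \<open>B_set\<close>, and \<open>A_set\<close> is in general an infinite union of such
  sets. Both limits rest on one estimate: at most \<open>(N + 2) / \<lambda>\<close> of the
  \<open>n \<le> N\<close> are hit by \<lambda> in each of the two windows. It has no additive
  error, so it can be summed over all \<open>\<lambda> > M\<close> uniformly in \<open>N\<close>.
  Positivity comes from \<open>\<lambda> > 2\<close> and the convergent sum.\<close>

definition rat_eval :: "rat poly \<Rightarrow> 'a::field_char_0 \<Rightarrow> 'a" where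
  "rat_eval f x = poly (map_poly of_rat f) x"

lemma rat_eval_0 [simp]: "rat_eval 0 x = 0"
  by (simp add: rat_eval_def)

lemma rat_eval_pCons [simp]: "rat_eval (pCons a f) x = of_rat a + x * rat_eval f x"
  by (cases "a = 0 \<and> f = 0") (auto simp: rat_eval_def map_poly_pCons)

lemma rat_eval_add: "rat_eval (f + g) x = rat_eval f x + rat_eval g x"
  by (induction f g rule: poly_induct2) (auto simp: of_rat_add algebra_simps)

lemma rat_eval_smult: "rat_eval (smult c f) x = of_rat c * rat_eval f x"
  by (induction f) (auto simp: of_rat_mult algebra_simps)

lemma rat_eval_mult: "rat_eval (f * g) x = rat_eval f x * rat_eval g x"
  by (induction f) (auto simp: rat_eval_add rat_eval_smult algebra_simps)

lemma rat_eval_monom: "rat_eval (monom c n) x = of_rat c * x ^ n"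
  by (simp add: rat_eval_def poly_monom map_poly_monom)

lemma norm_of_rat_complex: "norm (of_rat q :: complex) = \<bar>of_rat q\<bar>"
  by (cases q) (simp add: of_rat_rat norm_divide)

text \<open>
  All complex roots of \<open>X^d - \<alpha>^d\<close> have modulus \<open>\<alpha>\<close>, so the constant term of a factor of degree
  \<open>e\<close> is \<open>\<alpha>^e\<close> up to sign.
\<close>
lemma real_radical_inverse:
  fixes \<alpha> :: real and f :: "rat poly"
  assumes pos: "\<alpha> > 0" and d: "d > 0" and q: "\<alpha> ^ d = of_rat q"
    and min: "\<And>e. 0 < e \<Longrightarrow> e < d \<Longrightarrow> \<alpha> ^ e \<notin> \<rat>"
    and f: "f \<noteq> 0" "degree f < d"
  shows "\<exists>u. rat_eval u \<alpha> * rat_eval f \<alpha> = 1"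
proof -
  define P where "P = monom 1 d + [:-q:]"
  \<comment> \<open>The aim is \<open>degree g = 0\<close>: then \<open>f\<close> and
    \<open>P\<close> are coprime, and Bezout evaluated at \<alpha>, where \<open>P\<close> vanishes,
    inverts the value of \<open>f\<close>.\<close>
  define g where "g = gcd f P"
  \<comment> \<open>Stated for any field of characteristic 0, since it is used both at complex roots
    and at the real number \<alpha>.\<close>
  have evP: "rat_eval P x = x ^ d - of_rat q" for x :: "'b::field_char_0"
    by (simp add: P_def rat_eval_add rat_eval_monom of_rat_minus)
  have g0: "g \<noteq> 0" using f by (simp add: g_def)
  have dg: "degree g < d"
    using f dvd_imp_degree_le[of g f] by (simp add: g_def)
  define gc where "gc = map_poly (of_rat :: rat \<Rightarrow> complex) g"
  have gc0: "gc \<noteq> 0" using g0 by (simp add: gc_def map_poly_eq_0_iff)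
  have dgc: "degree gc = degree g" by (simp add: gc_def degree_map_poly)
  obtain A where A: "size A = degree gc" "gc = smult (lead_coeff gc) (\<Prod>x\<in>#A. [:-x, 1:])"
    using alg_closed_imp_factorization[OF gc0] by blast
  have root: "norm a = \<alpha>" if "a \<in># A" for a
  proof -
    have "poly gc a = 0"
      using that by (subst A(2)) (auto simp: poly_prod_mset prod_mset_zero_iff)
    hence "rat_eval g a = 0" by (simp add: gc_def rat_eval_def)
    moreover obtain h where "P = g * h" unfolding g_def by (meson dvd_def gcd_dvd2)
    ultimately have "rat_eval P a = 0" by (simp add: rat_eval_mult)
    hence "a ^ d = of_rat q" by (simp add: evP)
    hence "norm a ^ d = \<bar>of_rat q\<bar>" by (metis norm_of_rat_complex norm_power)
    also have "\<dots> = \<alpha> ^ d" using q pos by (metis abs_of_pos zero_less_power)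
    finally show ?thesis using pos d power_eq_iff_eq_base[of d "norm a" \<alpha>] by simp
  qed
  have "norm (poly gc 0) = norm (lead_coeff gc) * (\<Prod>x\<in>#A. norm x)"
  proof -
    have "norm (poly (\<Prod>x\<in>#A. [:-x, 1:]) 0) = (\<Prod>x\<in>#A. norm x)"
      by (induction A) (auto simp: norm_mult)
    thus ?thesis by (subst A(2)) (simp add: norm_mult)
  qed
  also have "(\<Prod>x\<in>#A. norm x) = (\<Prod>x\<in>#A. \<alpha>)"
    by (intro arg_cong[where f = prod_mset] image_mset_cong root)
  also have "\<dots> = \<alpha> ^ degree g" by (simp add: A(1) dgc)
  finally have eq: "\<bar>of_rat (coeff g 0)\<bar> = \<bar>of_rat (lead_coeff g)\<bar> * \<alpha> ^ degree g"
    by (simp add: gc_def norm_of_rat_complex poly_0_coeff_0 coeff_map_poly degree_map_poly)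
  have "\<alpha> ^ degree g = \<bar>of_rat (coeff g 0)\<bar> / \<bar>of_rat (lead_coeff g)\<bar>"
    using g0 unfolding eq by simp
  hence "\<alpha> ^ degree g \<in> \<rat>" by (simp add: Rats_divide Rats_abs_iff)
  with min dg have "degree g = 0" by blast
  then obtain c where c: "g = [:c:]" by (elim degree_eq_zeroE)
  have cz: "c \<noteq> 0" using c g0 by simp
  have "fst (bezout_coefficients f P) * f + snd (bezout_coefficients f P) * P = g"
    unfolding g_def by (rule bezout_coefficients_fst_snd)
  hence "rat_eval (fst (bezout_coefficients f P)) \<alpha> * rat_eval f \<alpha> = of_rat c"
    using arg_cong[where f = "\<lambda>f. rat_eval f \<alpha>"] evP[of \<alpha>] q c
    by (metis rat_eval_add rat_eval_mult rat_eval_pCons rat_eval_0 add.right_neutral diff_self mult_zero_right)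
  hence "rat_eval (smult (1/c) (fst (bezout_coefficients f P))) \<alpha> * rat_eval f \<alpha> = 1"
    using cz by (simp add: rat_eval_smult of_rat_divide)
  thus ?thesis by blast
qed

section \<open>Traces of multiplication by a radical on rational spaces\<close>

interpretation rat_real: vector_space "\<lambda>(q::rat) (x::real). of_rat q * x"
  by unfold_locales (auto simp: algebra_simps of_rat_add of_rat_mult)

text \<open>Sum of the diagonal matrix entries. It is the trace when \<open>B\<close> is finite and
  independent and \<open>f\<close> is linear and preserves its span; outside the span
  \<open>representation\<close> has the default value 0.\<close>

definition (in vector_space) trace_on :: "'b set \<Rightarrow> ('b \<Rightarrow> 'b) \<Rightarrow> 'a" where
  "trace_on B f = (\<Sum>b\<in>B. representation B (f b) b)"

text \<open>Expanding \<open>B\<close> in terms of \<open>C\<close> and each \<open>f c\<close> in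
  terms of \<open>B\<close> gives two matrices whose products in the two orders have the same trace;
  here both traces become one double sum with the summations exchanged.\<close>

lemma (in vector_space) trace_on_basis_indep:
  assumes B: "independent B" "finite B" and C: "independent C" "finite C" "span C = span B"
    and add: "\<And>x y. f (x + y) = f x + f y" and sc: "\<And>r x. f (scale r x) = scale r (f x)"
    and f: "\<And>x. x \<in> span B \<Longrightarrow> f x \<in> span B"
  shows "trace_on B f = trace_on C f"
proof -
  have f0: "f 0 = 0" using sc[of 0 0] by simp
  have fsum: "f (sum g A) = (\<Sum>a\<in>A. f (g a))" for g :: "'c \<Rightarrow> 'b" and A
    by (induction A rule: infinite_finite_induct) (auto simp: f0 add)
  have expand: "representation B (f b) b =
      (\<Sum>c\<in>C. representation C b c * representation B (f c) b)" if "b \<in> B" for b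
  proof -
    have bC: "b \<in> span C" using that C(3) span_base by blast
    have "f b = f (\<Sum>c\<in>C. scale (representation C b c) c)"
      by (simp only: sum_representation_eq[OF C(1) bC C(2) subset_refl])
    also have "\<dots> = (\<Sum>c\<in>C. scale (representation C b c) (f c))"
      by (simp only: fsum sc)
    finally have "f b = (\<Sum>c\<in>C. scale (representation C b c) (f c))" .
    moreover have "f c \<in> span B" if "c \<in> C" for c using that C(3) f span_base by blast
    ultimately show ?thesis
      by (simp add: representation_sum[OF B(1)] span_scale representation_scale[OF B(1)])
  qed
  have contract: "(\<Sum>b\<in>B. representation C b c * representation B (f c) b) =
      representation C (f c) c" if "c \<in> C" for c
  proof -
    have fcB: "f c \<in> span B" using that C(3) f span_base by blast
    have bC: "b \<in> span C" if "b \<in> B" for b using that C(3) span_base by blast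
    have "representation C (f c) c =
        representation C (\<Sum>b\<in>B. scale (representation B (f c) b) b) c"
      by (simp only: sum_representation_eq[OF B(1) fcB B(2) subset_refl])
    also have "\<dots> = (\<Sum>b\<in>B. representation B (f c) b * representation C b c)"
      by (subst representation_sum[OF C(1)])
         (auto intro: span_scale[OF bC] sum.cong simp: representation_scale[OF C(1) bC])
    finally show ?thesis by (simp add: mult.commute)
  qed
  have "trace_on B f = (\<Sum>b\<in>B. \<Sum>c\<in>C. representation C b c * representation B (f c) b)"
    by (simp add: trace_on_def expand)
  also have "\<dots> = (\<Sum>c\<in>C. \<Sum>b\<in>B. representation C b c * representation B (f c) b)"
    by (rule sum.swap)
  also have "\<dots> = trace_on C f" by (simp add: trace_on_def contract)
  finally show ?thesis .
qed


context
  fixes \<alpha> :: real and d :: nat and q :: rat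
  assumes pos: "\<alpha> > 0" and d: "d > 0" and q: "\<alpha> ^ d = of_rat q"
    and min: "\<And>e. 0 < e \<Longrightarrow> e < d \<Longrightarrow> \<alpha> ^ e \<notin> \<rat>"
begin

text \<open>As in the tower law: the power basis of the field generated by \<alpha>, times
  \<open>W\<close>. Multiplication by \<alpha> shifts the exponent, and the last power wraps around
  to \<open>q\<close> times the first.\<close>

definition radical_orbit :: "real set \<Rightarrow> real set" where
  "radical_orbit W = (\<lambda>(i, w). \<alpha> ^ i * w) ` ({..<d} \<times> W)"

lemma radical_orbitI: "i < d \<Longrightarrow> w \<in> W \<Longrightarrow> \<alpha> ^ i * w \<in> radical_orbit W"
  by (force simp: radical_orbit_def)

lemma span_radical_orbit_mult:
  assumes "x \<in> rat_real.span (radical_orbit W)"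
  shows "\<alpha> * x \<in> rat_real.span (radical_orbit W)"
  using assms
proof (induction rule: rat_real.span_induct_alt)
  case base
  show ?case by (simp add: rat_real.span_zero)
next
  case (step c x y)
  obtain i w where iw: "i < d" "w \<in> W" "x = \<alpha> ^ i * w"
    using step(1) by (auto simp: radical_orbit_def)
  have "\<alpha> * x \<in> rat_real.span (radical_orbit W)"
  proof (cases "Suc i < d")
    case True
    thus ?thesis using radical_orbitI[OF True iw(2)] iw(3)
      by (intro rat_real.span_base) (simp add: mult.assoc)
  next
    case False
    hence "Suc i = d" using iw(1) by simp
    hence "\<alpha> * x = of_rat q * w" using iw(3) q by (metis mult.assoc power_Suc)
    thus ?thesis using rat_real.span_scale[OF rat_real.span_base[OF radical_orbitI[OF d iw(2)]], of q]
      by simp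
  qed
  hence "of_rat c * (\<alpha> * x) + \<alpha> * y \<in> rat_real.span (radical_orbit W)"
    using step by (intro rat_real.span_add rat_real.span_scale)
  thus ?case by (simp add: algebra_simps)
qed

lemma span_radical_orbit_rat_eval:
  assumes "x \<in> rat_real.span (radical_orbit W)"
  shows "rat_eval f \<alpha> * x \<in> rat_real.span (radical_orbit W)"
proof (induction f)
  case 0
  show ?case by (simp add: rat_real.span_zero)
next
  case (pCons a f)
  have "of_rat a * x + \<alpha> * (rat_eval f \<alpha> * x) \<in> rat_real.span (radical_orbit W)"
    using assms pCons by (intro rat_real.span_add rat_real.span_scale span_radical_orbit_mult)
  thus ?case by (simp add: algebra_simps)
qed

text \<open>The degree bound is phrased by vanishing coefficients because
  \<open>degree f < j\<close> would fail for \<open>j = 0\<close>, where \<open>f\<close> has to be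
  0.\<close>

lemma span_powers_rat_eval:
  assumes "x \<in> rat_real.span ((\<lambda>i. \<alpha> ^ i * t) ` {..<j})"
  shows "\<exists>f. (\<forall>i\<ge>j. coeff f i = 0) \<and> x = rat_eval f \<alpha> * t"
  using assms
proof (induction rule: rat_real.span_induct_alt)
  case base
  show ?case by (intro exI[of _ 0]) auto
next
  case (step c x y)
  then obtain f i where f: "\<forall>i\<ge>j. coeff f i = 0" "y = rat_eval f \<alpha> * t" "i < j" "x = \<alpha> ^ i * t"
    by auto
  show ?case
    using f by (intro exI[of _ "monom c i + f"]) (auto simp: rat_eval_add rat_eval_monom algebra_simps)
qed

text \<open>The span of an orbit is closed under rational polynomials in \<alpha>, and nonzero ones
  of degree below \<open>d\<close> are invertible. A relation involving the powers
  \<open>\<alpha> ^ i * t\<close> could thus be solved for \<open>t\<close>, which would put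
  \<open>t\<close> into that span.\<close>

lemma radical_orbit_insert_independent:
  assumes W: "rat_real.independent (radical_orbit W)" and t: "t \<notin> rat_real.span (radical_orbit W)"
    and j: "j \<le> d"
  shows "rat_real.independent (radical_orbit W \<union> (\<lambda>i. \<alpha> ^ i * t) ` {..<j})"
  using j
proof (induction j)
  case 0
  thus ?case using W by simp
next
  case (Suc j)
  let ?U = "rat_real.span (radical_orbit W)"
  have "\<alpha> ^ j * t \<notin> rat_real.span (radical_orbit W \<union> (\<lambda>i. \<alpha> ^ i * t) ` {..<j})"
  proof
    assume "\<alpha> ^ j * t \<in> rat_real.span (radical_orbit W \<union> (\<lambda>i. \<alpha> ^ i * t) ` {..<j})"
    then obtain u f where uf: "u \<in> ?U" "\<alpha> ^ j * t = u + rat_eval f \<alpha> * t" "\<forall>i\<ge>j. coeff f i = 0"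
      using span_powers_rat_eval unfolding rat_real.span_Un by blast
    \<comment> \<open>Collecting the multiples of \<open>t\<close> on one side leaves a monic
      polynomial of degree \<open>j < d\<close>, hence an invertible value at \<alpha>.\<close>
    define g where "g = monom 1 j + smult (-1) f"
    have gu: "rat_eval g \<alpha> * t = u"
      using uf(2) by (simp add: g_def rat_eval_add rat_eval_monom rat_eval_smult algebra_simps
          of_rat_minus del: smult_minus_left)
    have "coeff g j = 1" using uf(3) by (simp add: g_def)
    hence "g \<noteq> 0" by auto
    moreover have "degree g \<le> j" using uf(3) by (intro degree_le) (auto simp: g_def)
    hence "degree g < d" using Suc.prems by simp
    ultimately obtain v where v: "rat_eval v \<alpha> * rat_eval g \<alpha> = 1"
      using real_radical_inverse[OF pos d q min] by blast
    have "rat_eval v \<alpha> * u \<in> ?U" using uf(1) by (rule span_radical_orbit_rat_eval)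
    moreover have "rat_eval v \<alpha> * u = t" using v gu by (metis mult.assoc mult_1)
    ultimately show False using t by simp
  qed
  hence "rat_real.independent (insert (\<alpha> ^ j * t) (radical_orbit W \<union> (\<lambda>i. \<alpha> ^ i * t) ` {..<j}))"
    using Suc by (intro rat_real.independent_insertI) auto
  thus ?case by (simp add: lessThan_Suc)
qed

text \<open>Greedy choice of a basis over the field generated by \<alpha>: a new \<open>t\<close>
  either lies in the span, and then its whole orbit does, or its whole orbit is added.\<close>

lemma radical_orbit_basis:
  assumes "finite T"
  shows "\<exists>W. finite W \<and> rat_real.independent (radical_orbit W) \<and>
    rat_real.span (radical_orbit W) = rat_real.span (radical_orbit T)"
  using assms
proof (induction T rule: finite_induct)
  case empty
  show ?case by (intro exI[of _ "{}"]) (auto simp: radical_orbit_def rat_real.independent_empty)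
next
  case (insert t T)
  then obtain W where W: "finite W" "rat_real.independent (radical_orbit W)"
    "rat_real.span (radical_orbit W) = rat_real.span (radical_orbit T)" by blast
  let ?P = "(\<lambda>i. \<alpha> ^ i * t) ` {..<d}"
  have ins: "radical_orbit (insert t X) = radical_orbit X \<union> ?P" for X
    by (auto simp: radical_orbit_def)
  show ?case
  proof (cases "t \<in> rat_real.span (radical_orbit W)")
    case True
    have "\<alpha> ^ i * t \<in> rat_real.span (radical_orbit W)" for i
      using span_radical_orbit_rat_eval[OF True, of "monom 1 i"] by (simp add: rat_eval_monom)
    hence "?P \<subseteq> rat_real.span (radical_orbit T)" using W(3) by auto
    hence "rat_real.span (radical_orbit (insert t T)) = rat_real.span (radical_orbit T)"
      unfolding ins using rat_real.span_superset
      by (subst rat_real.span_eq) (auto intro: rat_real.span_base)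
    thus ?thesis using W by blast
  next
    case False
    have "rat_real.independent (radical_orbit (insert t W))"
      unfolding ins using radical_orbit_insert_independent[OF W(2) False, of d] by simp
    moreover have "rat_real.span (radical_orbit (insert t W)) = rat_real.span (radical_orbit (insert t T))"
      unfolding ins rat_real.span_Un W(3) ..
    ultimately show ?thesis using W(1) by blast
  qed
qed

text \<open>Since the span of \<open>T\<close> is stable under \<alpha>, it has a basis of full
  orbits. There every diagonal entry is 0: the image of a basis vector is either the next vector of
  its orbit or \<open>q\<close> times the first one.\<close>

lemma trace_radical_eq_0:
  assumes irr: "\<alpha> \<notin> \<rat>" and T: "finite T" "\<And>t. t \<in> T \<Longrightarrow> \<alpha> * t \<in> rat_real.span T"
    and B: "rat_real.independent B" "finite B" "rat_real.span B = rat_real.span T"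
  shows "rat_real.trace_on B (\<lambda>x. \<alpha> * x) = 0"
proof -
  obtain W where W: "finite W" "rat_real.independent (radical_orbit W)"
    "rat_real.span (radical_orbit W) = rat_real.span (radical_orbit T)"
    using radical_orbit_basis[OF T(1)] by blast
  have mult: "\<alpha> * x \<in> rat_real.span T" if "x \<in> rat_real.span T" for x
    using that
  proof (induction rule: rat_real.span_induct_alt)
    case base
    show ?case by (simp add: rat_real.span_zero)
  next
    case (step c x y)
    hence "of_rat c * (\<alpha> * x) + \<alpha> * y \<in> rat_real.span T"
      using T by (intro rat_real.span_add rat_real.span_scale) auto
    thus ?case by (simp add: algebra_simps)
  qed
  have "\<alpha> ^ i * t \<in> rat_real.span T" if "t \<in> T" for i t
    using that by (induction i) (auto intro: rat_real.span_base mult simp: mult.assoc)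
  hence "radical_orbit T \<subseteq> rat_real.span T" by (auto simp: radical_orbit_def)
  moreover have "T \<subseteq> radical_orbit T" using radical_orbitI[OF d] by fastforce
  ultimately have "rat_real.span (radical_orbit T) = rat_real.span T"
    using rat_real.span_base by (subst rat_real.span_eq) blast
  hence spW: "rat_real.span (radical_orbit W) = rat_real.span B" using W(3) B(3) by simp
  have finW: "finite (radical_orbit W)" using W(1) by (simp add: radical_orbit_def)
  \<comment> \<open>Needed at the end of an orbit: \<open>d - 1\<close> is then a positive exponent
    below \<open>d\<close>, so \<open>\<alpha> ^ (d - 1)\<close> is irrational and the last vector
    differs from the first.\<close>
  have d1: "d > 1"
    using irr q d by (cases "d = 1") auto
  have "rat_real.trace_on B (\<lambda>x. \<alpha> * x) = rat_real.trace_on (radical_orbit W) (\<lambda>x. \<alpha> * x)"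
    by (rule rat_real.trace_on_basis_indep[OF B(1,2) W(2) finW spW])
       (use mult B(3) in \<open>auto simp: algebra_simps\<close>)
  also have "\<dots> = 0"
    unfolding rat_real.trace_on_def
  proof (rule sum.neutral, rule ballI)
    fix b assume b: "b \<in> radical_orbit W"
    then obtain i w where iw: "i < d" "w \<in> W" "b = \<alpha> ^ i * w"
      by (auto simp: radical_orbit_def)
    have b0: "b \<noteq> 0" using W(2) b rat_real.dependent_zero by blast
    show "rat_real.representation (radical_orbit W) (\<alpha> * b) b = 0"
    proof (cases "Suc i < d")
      case True
      have "\<alpha> * b = \<alpha> ^ Suc i * w" using iw by simp
      hence "\<alpha> * b \<in> radical_orbit W" using radical_orbitI[OF True iw(2)] by metis
      moreover have "\<alpha> * b \<noteq> b" using b0 irr by auto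
      ultimately show ?thesis by (simp add: rat_real.representation_basis[OF W(2)])
    next
      case False
      hence i: "Suc i = d" using iw(1) by simp
      have eq: "\<alpha> * b = of_rat q * w" using iw(3) q i by (metis mult.assoc power_Suc)
      have w: "w \<in> radical_orbit W" using radical_orbitI[OF d iw(2)] by simp
      have "\<alpha> ^ i \<notin> \<rat>" using min[of i] i d1 by auto
      hence "w \<noteq> b" using b0 iw(3) by auto
      thus ?thesis unfolding eq
        by (simp add: rat_real.representation_scale[OF W(2) rat_real.span_base[OF w]]
              rat_real.representation_basis[OF W(2) w])
    qed
  qed
  finally show ?thesis .
qed

end

text \<open>Multiplication by the left-hand side is the zero map on a nonzero finite-dimensional
  rational space. Its trace is \<open>c0\<close> times the dimension, because every radical
  contributes 0. Only the constant is treated: division by a radical moves any coefficient into that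
  place.\<close>

lemma radical_relation_const_eq_0:
  fixes A :: "real set" and c :: "real \<Rightarrow> rat"
  assumes A: "finite A" "\<And>a. a \<in> A \<Longrightarrow> a > 0" "\<And>a. a \<in> A \<Longrightarrow> a ^ k \<in> \<rat>" "\<And>a. a \<in> A \<Longrightarrow> a \<notin> \<rat>"
    and k: "k > 0" and rel: "of_rat c0 + (\<Sum>a\<in>A. of_rat (c a) * a) = 0"
  shows "c0 = 0"
proof -
  \<comment> \<open>Monomials with all exponents below \<open>k\<close>. Their span is closed under
    multiplication by each \<open>a\<close>, since \<open>a ^ k\<close> is rational.\<close>
  define T where "T = (\<lambda>e. \<Prod>a\<in>A. a ^ e a) ` (A \<rightarrow>\<^sub>E {..<k})"
  have finT: "finite T" unfolding T_def using A(1) by (intro finite_imageI finite_PiE) auto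
  have mult: "a * t \<in> rat_real.span T" if a: "a \<in> A" and t: "t \<in> T" for a t
  proof -
    obtain e where e: "e \<in> A \<rightarrow>\<^sub>E {..<k}" "t = (\<Prod>a\<in>A. a ^ e a)" using t by (auto simp: T_def)
    have at: "a * t = a ^ Suc (e a) * (\<Prod>x\<in>A-{a}. x ^ e x)"
      unfolding e(2) by (subst prod.remove[OF A(1) a]) simp
    show ?thesis
    proof (cases "Suc (e a) < k")
      case True
      let ?e = "e(a := Suc (e a))"
      have "?e \<in> A \<rightarrow>\<^sub>E {..<k}" using e(1) True a by (auto simp: PiE_iff extensional_def)
      moreover have "a * t = (\<Prod>x\<in>A. x ^ ?e x)"
        unfolding at by (subst prod.remove[OF A(1) a]) (auto intro!: prod.cong)
      ultimately have "a * t \<in> T" unfolding T_def by blast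
      thus ?thesis by (rule rat_real.span_base)
    next
      case False
      hence ek: "Suc (e a) = k" using e(1) a by (auto simp: PiE_iff)
      obtain r where r: "a ^ k = of_rat r" using A(3)[OF a] by (auto elim: Rats_cases)
      let ?e = "e(a := 0)"
      have "?e \<in> A \<rightarrow>\<^sub>E {..<k}" using e(1) k a by (auto simp: PiE_iff extensional_def)
      hence "(\<Prod>x\<in>A. x ^ ?e x) \<in> T" unfolding T_def by blast
      moreover have "a * t = of_rat r * (\<Prod>x\<in>A. x ^ ?e x)"
        unfolding at ek r by (subst prod.remove[OF A(1) a]) (auto intro!: prod.cong)
      ultimately show ?thesis using rat_real.span_scale rat_real.span_base by metis
    qed
  qed
  obtain B where B: "B \<subseteq> T" "rat_real.independent B" "T \<subseteq> rat_real.span B"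
    using rat_real.maximal_independent_subset[of T] by blast
  have finB: "finite B" using B(1) finT finite_subset by blast
  have spB: "rat_real.span B = rat_real.span T"
    using B rat_real.span_base by (subst rat_real.span_eq) blast
  have tr: "rat_real.trace_on B (\<lambda>x. a * x) = 0" if a: "a \<in> A" for a
  proof -
    \<comment> \<open>The common exponent \<open>k\<close> need not be minimal for \<open>a\<close>;
      the least one supplies the minimality on which the orbit argument depends.\<close>
    define d where "d = (LEAST d. d > 0 \<and> a ^ d \<in> \<rat>)"
    have d: "d > 0 \<and> a ^ d \<in> \<rat>" unfolding d_def by (rule LeastI[of _ k]) (use k A(3) a in auto)
    have min: "a ^ e \<notin> \<rat>" if "0 < e" "e < d" for e
      using not_less_Least[of e "\<lambda>d. d > 0 \<and> a ^ d \<in> \<rat>"] that unfolding d_def by auto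
    obtain q where q: "a ^ d = of_rat q" using d by (auto elim: Rats_cases)
    show ?thesis
      by (rule trace_radical_eq_0[OF _ _ q min _ finT _ B(2) finB spB]) (use a A d mult in auto)
  qed
  have sp: "a * b \<in> rat_real.span B" if "a \<in> A" "b \<in> B" for a b
    using that mult B(1) spB by auto
  \<comment> \<open>The relation is multiplied by each basis vector \<open>b\<close>, its
    coefficient at \<open>b\<close> is taken, and these are summed: this is the trace of the zero
    map.\<close>
  have "0 = (\<Sum>b\<in>B. rat_real.representation B 0 b)"
    by (simp add: rat_real.representation_zero)
  also have "\<dots> = (\<Sum>b\<in>B. c0 + (\<Sum>a\<in>A. c a * rat_real.representation B (a * b) b))"
  proof (rule sum.cong[OF refl])
    fix b assume b: "b \<in> B"
    have "0 = of_rat c0 * b + (\<Sum>a\<in>A. of_rat (c a) * (a * b))"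
      using arg_cong[OF rel, of "\<lambda>x. x * b"] by (simp add: algebra_simps sum_distrib_left)
    hence "rat_real.representation B 0 b =
        rat_real.representation B (of_rat c0 * b + (\<Sum>a\<in>A. of_rat (c a) * (a * b))) b"
      by (rule arg_cong)
    also have "\<dots> = rat_real.representation B (of_rat c0 * b) b +
        rat_real.representation B (\<Sum>a\<in>A. of_rat (c a) * (a * b)) b"
      using b sp by (subst rat_real.representation_add[OF B(2)])
        (auto intro!: rat_real.span_sum rat_real.span_scale rat_real.span_base[of b])
    also have "rat_real.representation B (of_rat c0 * b) b = c0"
      using b by (simp add: rat_real.representation_scale[OF B(2) rat_real.span_base]
          rat_real.representation_basis[OF B(2)])
    also have "rat_real.representation B (\<Sum>a\<in>A. of_rat (c a) * (a * b)) b =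
        (\<Sum>a\<in>A. c a * rat_real.representation B (a * b) b)"
      using b sp by (subst rat_real.representation_sum[OF B(2)])
        (auto intro: rat_real.span_scale simp: rat_real.representation_scale[OF B(2)])
    finally show "rat_real.representation B 0 b =
        c0 + (\<Sum>a\<in>A. c a * rat_real.representation B (a * b) b)" .
  qed
  also have "\<dots> = of_nat (card B) * c0 + (\<Sum>a\<in>A. c a * rat_real.trace_on B (\<lambda>x. a * x))"
    by (simp add: sum.distrib sum.swap[of _ A B] sum_distrib_left rat_real.trace_on_def)
  also have "\<dots> = of_nat (card B) * c0" by (simp add: tr)
  finally have "of_nat (card B) * c0 = 0" by simp
  \<comment> \<open>The empty monomial 1 lies in \<open>T\<close>, so the dimension is positive and
    may be cancelled.\<close>
  moreover have "B \<noteq> {}"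
  proof
    assume "B = {}"
    have "(\<lambda>a. if a \<in> A then 0 else undefined) \<in> A \<rightarrow>\<^sub>E {..<k}" using k by auto
    hence "(\<Prod>a\<in>A. a ^ (if a \<in> A then 0 else undefined)) \<in> T" unfolding T_def by (rule imageI)
    hence "1 \<in> T" by simp
    thus False using B(3) \<open>B = {}\<close> by auto
  qed
  ultimately show ?thesis using finB by simp
qed

section \<open>Weyl equidistribution\<close>

lemma cis_2pi_eq_1_imp_Ints:
  assumes "cis (2 * pi * x) = 1"
  shows "x \<in> \<int>"
proof -
  have "cos (2 * pi * x) = 1" using arg_cong[OF assms, of Re] by simp
  then obtain n :: int where "2 * pi * x = of_int n * 2 * pi" using cos_one_2pi_int by auto
  hence "x = of_int n" by simp
  thus ?thesis by simp
qed

lemma sum_cis_geometric: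
  assumes "\<theta> \<notin> \<int>"
  shows "(\<Sum>n<N. cis (2 * pi * \<theta> * real n)) = (cis (2 * pi * \<theta> * real N) - 1) / (cis (2 * pi * \<theta>) - 1)"
proof -
  have "cis (2 * pi * \<theta>) \<noteq> 1" using assms cis_2pi_eq_1_imp_Ints by blast
  moreover have "cis (2 * pi * \<theta> * real n) = cis (2 * pi * \<theta>) ^ n" for n
    by (simp add: Complex.DeMoivre mult_ac)
  ultimately show ?thesis by (simp add: geometric_sum)
qed

lemma cis_mean_tendsto_0:
  assumes "\<theta> \<notin> \<int>"
  shows "(\<lambda>N. (\<Sum>n\<in>{1..N}. cis (2 * pi * \<theta> * real n)) / of_nat N) \<longlonglongrightarrow> 0"
proof (rule Lim_null_comparison)
  define C where "C = 2 / norm (cis (2 * pi * \<theta>) - 1)"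
  show "\<forall>\<^sub>F N in sequentially. norm ((\<Sum>n\<in>{1..N}. cis (2 * pi * \<theta> * real n)) / of_nat N) \<le> C / real N"
  proof (rule always_eventually, rule allI)
    fix N
    have "(\<Sum>n\<in>{1..N}. cis (2 * pi * \<theta> * real n)) = (\<Sum>n<N. cis (2 * pi * \<theta> * real (Suc n)))"
      by (rule sum.reindex_bij_witness[of _ Suc "\<lambda>n. n - 1"]) auto
    also have "\<dots> = cis (2 * pi * \<theta>) * (\<Sum>n<N. cis (2 * pi * \<theta> * real n))"
      by (simp add: sum_distrib_left cis_mult algebra_simps)
    also have "norm \<dots> = norm (cis (2 * pi * \<theta> * real N) - 1) / norm (cis (2 * pi * \<theta>) - 1)"
      by (simp add: sum_cis_geometric[OF assms] norm_mult norm_divide)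
    also have "\<dots> \<le> C"
      unfolding C_def using norm_triangle_ineq4[of "cis (2 * pi * \<theta> * real N)" 1]
      by (intro divide_right_mono) auto
    finally show "norm ((\<Sum>n\<in>{1..N}. cis (2 * pi * \<theta> * real n)) / of_nat N) \<le> C / real N"
      by (simp add: norm_divide divide_right_mono)
  qed
  show "(\<lambda>N. C / real N) \<longlonglongrightarrow> 0" by (rule lim_const_over_n)
qed

text \<open>The index \<open>i\<close> stands for the frequency \<open>i - M x\<close>, so
  \<open>M x\<close> marks the constant term. In the expanded product each other choice of indices
  yields an exponential whose frequency is a nontrivial integer combination of the
  \<open>\<theta> x\<close>, hence not an integer, and has mean 0.\<close>

lemma trig_product_mean:
  fixes F :: "'a set" and \<theta> \<phi> :: "'a \<Rightarrow> real" and M :: "'a \<Rightarrow> nat" and c :: "'a \<Rightarrow> nat \<Rightarrow> complex"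
  assumes F: "finite F"
    and indep: "\<And>h :: 'a \<Rightarrow> int. \<exists>x\<in>F. h x \<noteq> 0 \<Longrightarrow> (\<Sum>x\<in>F. of_int (h x) * \<theta> x) \<notin> \<int>"
  shows "(\<lambda>N. (\<Sum>n\<in>{1..N}. \<Prod>x\<in>F. \<Sum>i\<le>2 * M x.
            c x i * cis (2 * pi * (real i - real (M x)) * (real n * \<theta> x + \<phi> x))) / of_nat N)
          \<longlonglongrightarrow> (\<Prod>x\<in>F. c x (M x))"
proof -
  define E where "E = (\<Pi>\<^sub>E x\<in>F. {..2 * M x})"
  \<comment> \<open>The choice with all frequencies 0; the restriction is needed because elements of
    \<open>E\<close> are \<open>undefined\<close> outside \<open>F\<close>.\<close>
  define e0 where "e0 = restrict M F"
  define \<psi> where "\<psi> e = (\<Sum>x\<in>F. (real (e x) - real (M x)) * \<theta> x)" for e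
  define C where "C e = (\<Prod>x\<in>F. c x (e x) * cis (2 * pi * (real (e x) - real (M x)) * \<phi> x))" for e
  have finE: "finite E" unfolding E_def using F by (intro finite_PiE) auto
  have e0E: "e0 \<in> E" by (auto simp: e0_def E_def)
  have C0: "C e0 = (\<Prod>x\<in>F. c x (M x))" by (auto simp: C_def e0_def intro!: prod.cong)
  have cis_sum: "(\<Prod>x\<in>F. cis (f x)) = cis (\<Sum>x\<in>F. f x)" for f
    using F by (induction F rule: finite_induct) (auto simp: cis_mult)
  have expand: "(\<Prod>x\<in>F. \<Sum>i\<le>2 * M x.
      c x i * cis (2 * pi * (real i - real (M x)) * (real n * \<theta> x + \<phi> x))) =
      (\<Sum>e\<in>E. C e * cis (2 * pi * \<psi> e * real n))" for n
  proof -
    have "(\<Prod>x\<in>F. \<Sum>i\<le>2 * M x.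
        c x i * cis (2 * pi * (real i - real (M x)) * (real n * \<theta> x + \<phi> x))) =
        (\<Sum>e\<in>E. \<Prod>x\<in>F. c x (e x) * cis (2 * pi * (real (e x) - real (M x)) * (real n * \<theta> x + \<phi> x)))"
      unfolding E_def using F by (intro prod_sum_PiE) auto
    also have "\<dots> = (\<Sum>e\<in>E. C e * cis (2 * pi * \<psi> e * real n))"
    proof (rule sum.cong[OF refl])
      fix e
      have "(\<Prod>x\<in>F. c x (e x) * cis (2 * pi * (real (e x) - real (M x)) * (real n * \<theta> x + \<phi> x))) =
        (\<Prod>x\<in>F. (c x (e x) * cis (2 * pi * (real (e x) - real (M x)) * \<phi> x)) *
              cis (2 * pi * ((real (e x) - real (M x)) * \<theta> x) * real n))"
        by (intro prod.cong refl) (simp add: mult.assoc cis_mult algebra_simps)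
      also have "\<dots> = C e * cis (2 * pi * \<psi> e * real n)"
        by (simp add: prod.distrib C_def cis_sum \<psi>_def sum_distrib_left sum_distrib_right mult_ac)
      finally show "(\<Prod>x\<in>F. c x (e x) * cis (2 * pi * (real (e x) - real (M x)) * (real n * \<theta> x + \<phi> x))) =
          C e * cis (2 * pi * \<psi> e * real n)" .
    qed
    finally show ?thesis .
  qed
  have lim: "(\<lambda>N. C e * ((\<Sum>n\<in>{1..N}. cis (2 * pi * \<psi> e * real n)) / of_nat N))
      \<longlonglongrightarrow> (if e = e0 then C e else 0)" if e: "e \<in> E" for e
  proof (cases "e = e0")
    case True
    hence "\<psi> e = 0" by (simp add: \<psi>_def e0_def)
    hence "\<forall>\<^sub>F N in sequentially. C e = C e * ((\<Sum>n\<in>{1..N}. cis (2 * pi * \<psi> e * real n)) / of_nat N)"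
      using eventually_gt_at_top[of 0] by (auto elim!: eventually_mono)
    thus ?thesis using True Lim_transform_eventually[OF tendsto_const] by auto
  next
    case False
    have "\<exists>x\<in>F. e x \<noteq> M x"
    proof (rule ccontr)
      assume "\<not> (\<exists>x\<in>F. e x \<noteq> M x)"
      hence "e = e0" using e by (intro ext) (auto simp: e0_def E_def PiE_iff extensional_def)
      thus False using False by simp
    qed
    hence "(\<Sum>x\<in>F. of_int (int (e x) - int (M x)) * \<theta> x) \<notin> \<int>"
      by (intro indep) auto
    hence "\<psi> e \<notin> \<int>" by (simp add: \<psi>_def)
    from tendsto_mult_right_zero[OF cis_mean_tendsto_0[OF this], of "C e"] False show ?thesis by simp
  qed
  have "(\<lambda>N. \<Sum>e\<in>E. C e * ((\<Sum>n\<in>{1..N}. cis (2 * pi * \<psi> e * real n)) / of_nat N))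
      \<longlonglongrightarrow> (\<Sum>e\<in>E. if e = e0 then C e else 0)"
    by (intro tendsto_sum lim)
  also have "(\<Sum>e\<in>E. if e = e0 then C e else 0) = (\<Prod>x\<in>F. c x (M x))"
    using finE e0E C0 by (simp add: sum.delta)
  finally show ?thesis
    unfolding expand by (subst sum.swap) (simp add: sum_distrib_left sum_divide_distrib)
qed


section \<open>Trigonometric majorants of arcs\<close>

lemma card_nat_in_interval_le:
  fixes a b :: real
  assumes "a \<le> b"
  shows "finite {j::nat. a \<le> real j \<and> real j \<le> b}"
    and "real (card {j::nat. a \<le> real j \<and> real j \<le> b}) \<le> b - a + 1"
proof -
  have sub: "int ` {j::nat. a \<le> real j \<and> real j \<le> b} \<subseteq> {\<lceil>a\<rceil>..\<lfloor>b\<rfloor>}"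
    by (auto simp: ceiling_le_iff le_floor_iff)
  hence fin: "finite (int ` {j::nat. a \<le> real j \<and> real j \<le> b})"
    using finite_subset by blast
  thus "finite {j::nat. a \<le> real j \<and> real j \<le> b}" by (rule finite_imageD) auto
  have "card {j::nat. a \<le> real j \<and> real j \<le> b} = card (int ` {j::nat. a \<le> real j \<and> real j \<le> b})"
    by (simp add: card_image)
  also have "\<dots> \<le> card {\<lceil>a\<rceil>..\<lfloor>b\<rfloor>}" using sub by (intro card_mono) auto
  also have "\<dots> = nat (\<lfloor>b\<rfloor> - \<lceil>a\<rceil> + 1)" by simp
  finally have "real (card {j::nat. a \<le> real j \<and> real j \<le> b}) \<le> real (nat (\<lfloor>b\<rfloor> - \<lceil>a\<rceil> + 1))"
    by linarith
  also have "\<dots> \<le> b - a + 1"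
    using assms by (cases "\<lfloor>b\<rfloor> - \<lceil>a\<rceil> + 1 \<ge> 0") (simp_all, linarith+)
  finally show "real (card {j::nat. a \<le> real j \<and> real j \<le> b}) \<le> b - a + 1" .
qed

text \<open>Discrete orthogonality: nonzero frequencies have absolute value below \<open>q\<close>,
  so their sums over the \<open>q\<close> equally spaced points vanish. The constant coefficient is
  thereby obtained from finitely many values, without integrals.\<close>

lemma trig_coeff_0_eq_average:
  fixes c :: "nat \<Rightarrow> complex"
  assumes q: "q > 2 * M"
  shows "(\<Sum>j<q. \<Sum>i\<le>2 * M. c i * cis (2 * pi * (real i - real M) * (real j / real q))) = of_nat q * c M"
proof -
  have "(\<Sum>j<q. cis (2 * pi * (real i - real M) * (real j / real q))) = (if i = M then of_nat q else 0)"
    if i: "i \<le> 2 * M" for i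
  proof (cases "i = M")
    case False
    define \<theta> where "\<theta> = (real i - real M) / real q"
    have "\<bar>real i - real M\<bar> < real q" using i q by linarith
    hence "\<bar>\<theta>\<bar> < 1" using q by (simp add: \<theta>_def abs_divide divide_less_eq)
    moreover have "\<theta> \<noteq> 0" using False q by (simp add: \<theta>_def)
    ultimately have "\<theta> \<notin> \<int>" by (auto elim!: Ints_cases)
    moreover have "cis (2 * pi * \<theta> * real q) = 1"
      using q cis_multiple_2pi[of "real i - real M"] by (simp add: \<theta>_def)
    ultimately have "(\<Sum>j<q. cis (2 * pi * \<theta> * real j)) = 0"
      by (simp add: sum_cis_geometric)
    thus ?thesis using False by (simp add: \<theta>_def)
  qed auto
  hence "(\<Sum>i\<le>2 * M. c i * (\<Sum>j<q. cis (2 * pi * (real i - real M) * (real j / real q)))) =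
      (\<Sum>i\<le>2 * M. if i = M then of_nat q * c i else 0)"
    by (intro sum.cong) auto
  thus ?thesis by (subst sum.swap) (simp add: sum_distrib_left)
qed

text \<open>With \<open>z = cis (2 * pi * t)\<close> and \<open>y\<close> the squared sine,
  \<open>y * z\<close> and \<open>(1 - y) * z\<close> are quadratic polynomials in \<open>z\<close>.
  This is what turns Bernstein polynomials in \<open>y\<close> into trigonometric
  polynomials.\<close>

lemma sin_squared_cis:
  "of_real ((sin (pi * t))\<^sup>2) * cis (2 * pi * t) = - (1 / 4) * (cis (2 * pi * t) - 1)\<^sup>2"
  "of_real (1 - (sin (pi * t))\<^sup>2) * cis (2 * pi * t) = (1 / 4) * (cis (2 * pi * t) + 1)\<^sup>2"
proof -
  define z where "z = cis (2 * pi * t)"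
  have "(sin (pi * t))\<^sup>2 = (1 - cos (2 * (pi * t))) / 2"
    using cos_double_sin[of "pi * t"] by simp
  hence s: "of_real ((sin (pi * t))\<^sup>2) = (1 - (z + cnj z) / 2) / 2"
    by (simp add: z_def complex_eq_iff mult.assoc)
  have zz: "z * cnj z = 1" by (simp add: z_def cis_mult cis_cnj)
  show "of_real ((sin (pi * t))\<^sup>2) * cis (2 * pi * t) = - (1 / 4) * (cis (2 * pi * t) - 1)\<^sup>2"
  proof -
    have "(1 - (z + cnj z) / 2) / 2 * z = (2 * z - z * z - z * cnj z) / 4" by (simp add: field_simps)
    also have "\<dots> = - (1 / 4) * (z - 1)\<^sup>2" unfolding zz by (simp add: power2_eq_square field_simps)
    finally show ?thesis unfolding s z_def[symmetric] .
  qed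
  show "of_real (1 - (sin (pi * t))\<^sup>2) * cis (2 * pi * t) = (1 / 4) * (cis (2 * pi * t) + 1)\<^sup>2"
  proof -
    have "(1 - (1 - (z + cnj z) / 2) / 2) * z = (2 * z + z * z + z * cnj z) / 4" by (simp add: field_simps)
    also have "\<dots> = (1 / 4) * (z + 1)\<^sup>2" unfolding zz by (simp add: power2_eq_square field_simps)
    finally show ?thesis unfolding of_real_diff of_real_1 s z_def[symmetric] .
  qed
qed

text \<open>Multiplied by \<open>z ^ n\<close>, the left-hand side is a polynomial of degree at most
  \<open>2 * n\<close> in \<open>z\<close>; dividing by \<open>z ^ n\<close> again leaves
  frequencies from \<open>-n\<close> to \<open>n\<close>. The constant \<open>b\<close> serves to
  lift an approximation above its target.\<close>

lemma bernstein_sin_squared_trig: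
  fixes a :: "nat \<Rightarrow> real" and b :: real
  shows "\<exists>c. \<forall>t. of_real (b + (\<Sum>k\<le>n. a k * Bernstein n k ((sin (pi * t))\<^sup>2))) =
      (\<Sum>i\<le>2 * n. c i * cis (2 * pi * (real i - real n) * t))"
proof -
  define p1 p2 :: "complex poly" where "p1 = smult (- (1/4)) ([:-1, 1:] ^ 2)" and "p2 = smult (1/4) ([:1, 1:] ^ 2)"
  define Q where "Q = monom (of_real b) n +
      (\<Sum>k\<le>n. smult (of_real (a k * real (n choose k))) (p1 ^ k * p2 ^ (n - k)))"
  have dp: "degree p1 \<le> 2" "degree p2 \<le> 2"
    unfolding p1_def p2_def
    by (rule order_trans[OF degree_smult_le order_trans[OF degree_power_le]], simp)+
  have "degree (p1 ^ k * p2 ^ (n - k)) \<le> 2 * n" if "k \<le> n" for k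
  proof -
    have "degree (p1 ^ k * p2 ^ (n - k)) \<le> degree (p1 ^ k) + degree (p2 ^ (n - k))" by (rule degree_mult_le)
    also have "\<dots> \<le> degree p1 * k + degree p2 * (n - k)" by (intro add_mono degree_power_le)
    also have "\<dots> \<le> 2 * k + 2 * (n - k)" using dp by (intro add_mono mult_right_mono) auto
    finally show ?thesis using that by simp
  qed
  hence "degree Q \<le> 2 * n"
    unfolding Q_def
    by (intro degree_add_le degree_sum_le order_trans[OF degree_smult_le] order_trans[OF degree_monom_le]) auto
  hence Qsum: "poly Q z = (\<Sum>i\<le>2 * n. coeff Q i * z ^ i)" for z
    by (subst poly_altdef) (intro sum.mono_neutral_left, auto simp: coeff_eq_0)
  have "of_real (b + (\<Sum>k\<le>n. a k * Bernstein n k ((sin (pi * t))\<^sup>2))) =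
      (\<Sum>i\<le>2 * n. coeff Q i * cis (2 * pi * (real i - real n) * t))" for t
  proof -
    define y z where "y = complex_of_real ((sin (pi * t))\<^sup>2)" and "z = cis (2 * pi * t)"
    have y1: "poly p1 z = y * z" "poly p2 z = (1 - y) * z"
      using sin_squared_cis[of t] by (simp_all add: p1_def p2_def y_def z_def poly_power add.commute)
    have "poly Q z = of_real b * z ^ n +
        (\<Sum>k\<le>n. of_real (a k * real (n choose k)) * ((y * z) ^ k * ((1 - y) * z) ^ (n - k)))"
      by (simp add: Q_def poly_sum poly_power y1 poly_monom)
    also have "\<dots> = of_real b * z ^ n +
        (\<Sum>k\<le>n. of_real (a k * real (n choose k)) * (y ^ k * (1 - y) ^ (n - k)) * z ^ n)"
    proof (intro arg_cong2[where f = "(+)"] sum.cong refl)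
      fix k assume "k \<in> {..n}"
      hence "z ^ n = z ^ k * z ^ (n - k)" by (simp flip: power_add)
      thus "of_real (a k * real (n choose k)) * ((y * z) ^ k * ((1 - y) * z) ^ (n - k)) =
         of_real (a k * real (n choose k)) * (y ^ k * (1 - y) ^ (n - k)) * z ^ n"
        by (simp add: power_mult_distrib)
    qed
    also have "\<dots> = of_real (b + (\<Sum>k\<le>n. a k * Bernstein n k ((sin (pi * t))\<^sup>2))) * z ^ n"
      by (simp add: Bernstein_def y_def sum_distrib_right ring_distribs mult.assoc)
    finally have e1: "poly Q z = of_real (b + (\<Sum>k\<le>n. a k * Bernstein n k ((sin (pi * t))\<^sup>2))) * z ^ n" .
    have zi: "z ^ i = cis (2 * pi * (real i - real n) * t) * z ^ n" for i
      by (simp add: z_def Complex.DeMoivre cis_mult algebra_simps)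
    have e2: "poly Q z = (\<Sum>i\<le>2 * n. coeff Q i * cis (2 * pi * (real i - real n) * t)) * z ^ n"
      unfolding Qsum sum_distrib_right by (intro sum.cong refl) (subst zi, simp)
    have "z ^ n \<noteq> 0" by (simp add: z_def)
    thus ?thesis by (rule mult_right_cancel[THEN iffD1]) (rule trans[OF e1[symmetric] e2])
  qed
  thus ?thesis by blast
qed

text \<open>The squared sine is \<open>(cos (pi * u))\<^sup>2\<close>, where \<open>u\<close> is the
  distance to \<open>1/2 + m\<close>, and this decreases for \<open>u\<close> in [0, 1/2]. Arcs
  centred at 1/2 modulo 1 are therefore superlevel sets of it.\<close>

lemma sin_squared_near_half:
  assumes "\<bar>t - 1/2 - of_int m\<bar> \<le> r" "r \<le> 1/2"
  shows "(sin (pi * t))\<^sup>2 \<ge> (cos (pi * r))\<^sup>2"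
proof -
  define u where "u = \<bar>t - 1/2 - of_int m\<bar>"
  have "sin (pi * t) = sin (pi * (t - 1/2 - of_int m) + pi / 2 + pi * of_int m)"
    by (rule arg_cong[where f = sin]) (simp add: algebra_simps)
  also have "\<dots> = cos (pi * (t - 1/2 - of_int m)) * cos (pi * of_int m)"
    by (simp only: sin_add[of _ "pi * of_int m"] sin_npi_int sin_add[of _ "pi / 2"]
          sin_pi_half cos_pi_half mult_zero_right add_0_left add_0_right mult_1_right)
  finally have "\<bar>sin (pi * t)\<bar> = \<bar>cos (pi * (t - 1/2 - of_int m))\<bar>"
    by (simp only: abs_mult cos_npi_int) simp
  also have "cos (pi * (t - 1/2 - of_int m)) = cos (pi * u)"
    using cos_abs_real[of "pi * (t - 1/2 - of_int m)"] by (simp add: u_def abs_mult)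
  finally have e: "(sin (pi * t))\<^sup>2 = (cos (pi * u))\<^sup>2" by (metis power2_abs)
  have u: "0 \<le> u" "u \<le> r" using assms by (auto simp: u_def)
  have "cos (pi * r) \<le> cos (pi * u)"
    using u assms by (intro cos_monotone_0_pi_le) (auto simp: mult_left_mono)
  moreover have "0 \<le> cos (pi * r)"
    using u assms by (intro cos_ge_zero order_trans[of "- (pi / 2)" 0 "pi * r"]) auto
  ultimately show ?thesis unfolding e by (intro power_mono)
qed

lemma sin_squared_away_half:
  assumes "0 \<le> t" "t \<le> 1" "\<rho> \<le> \<bar>t - 1/2\<bar>" "0 \<le> \<rho>"
  shows "(sin (pi * t))\<^sup>2 \<le> (cos (pi * \<rho>))\<^sup>2"
proof -
  define u where "u = \<bar>t - 1/2\<bar>"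
  have u: "0 \<le> u" "u \<le> 1/2" "\<rho> \<le> u" using assms by (auto simp: u_def abs_if)
  have "sin (pi * t) = cos (pi / 2 - pi * t)" using sin_cos_eq[of "pi * t"] by simp
  also have "\<dots> = cos (- (pi * (t - 1/2)))" by (rule arg_cong[where f = cos]) (simp add: algebra_simps)
  also have "\<dots> = cos (pi * (t - 1/2))" by (rule cos_minus)
  also have "cos (pi * (t - 1/2)) = cos (pi * u)"
    using cos_abs_real[of "pi * (t - 1/2)"] by (simp add: u_def abs_mult)
  finally have e: "sin (pi * t) = cos (pi * u)" .
  have "cos (pi * u) \<le> cos (pi * \<rho>)"
    using u assms by (intro cos_monotone_0_pi_le) (auto simp: mult_left_mono)
  moreover have "0 \<le> cos (pi * u)"
    using u by (intro cos_ge_zero order_trans[of "- (pi / 2)" 0 "pi * u"]) auto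
  ultimately show ?thesis unfolding e by (intro power_mono)
qed

text \<open>Because the arc is centred at 1/2, a ramp \<open>f\<close> in the squared sine suffices,
  and the ordinary Weierstrass theorem on [0, 1] replaces trigonometric approximation. The ramp is 1
  on the arc and 0 from distance \<open>\<rho>\<close> on; raising the approximation by its error
  \<open>\<eta>\<close> makes it a nonnegative majorant.\<close>

lemma arc_majorant:
  fixes r \<epsilon> :: real
  assumes r: "0 \<le> r" "r < 1/2" and \<epsilon>: "\<epsilon> > 0"
  shows "\<exists>M c G c0. (\<forall>t. of_real (G t) = (\<Sum>i\<le>2 * M. c i * cis (2 * pi * (real i - real M) * t))) \<and>
    (\<forall>t. 0 \<le> G t) \<and> (\<forall>t. (\<exists>m::int. \<bar>t - 1/2 - of_int m\<bar> \<le> r) \<longrightarrow> 1 \<le> G t) \<and>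
    c M = of_real c0 \<and> 0 \<le> c0 \<and> c0 \<le> 2 * r + \<epsilon>"
proof -
  \<comment> \<open>The errors are \<open>2 * \<eta>\<close> from the approximation, at most
    \<open>2 * \<eta>\<close> from widening \<open>r\<close> to \<open>\<rho>\<close>, and at most
    \<open>\<eta>\<close> from \<open>1 / q\<close>: \<open>5 * \<eta>\<close> in all, within
    \<open>\<epsilon>\<close>.\<close>
  define \<eta> where "\<eta> = \<epsilon> / 8"
  define \<rho> where "\<rho> = r + min \<eta> (1/2 - r)"
  define s0 s1 where "s0 = (cos (pi * \<rho>))\<^sup>2" and "s1 = (cos (pi * r))\<^sup>2"
  define f where "f y = max 0 (min 1 ((y - s0) / (s1 - s0)))" for y
  have \<eta>: "\<eta> > 0" using \<epsilon> by (simp add: \<eta>_def)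
  have \<rho>: "r < \<rho>" "\<rho> \<le> 1/2" "\<rho> \<le> r + \<eta>" using r \<eta> by (auto simp: \<rho>_def min_def)
  have "cos (pi * \<rho>) < cos (pi * r)" using \<rho> r by (intro cos_monotone_0_pi) auto
  moreover have "0 \<le> cos (pi * \<rho>)"
    using \<rho> r by (intro cos_ge_zero order_trans[of "- (pi / 2)" 0 "pi * \<rho>"]) auto
  ultimately have s: "s0 < s1" unfolding s0_def s1_def by (intro power_strict_mono) auto
  have f01: "0 \<le> f y" "f y \<le> 1" for y by (auto simp: f_def)
  have f1: "f y = 1" if "y \<ge> s1" for y using that s by (simp add: f_def)
  have f0: "f y = 0" if "y \<le> s0" for y using that s by (simp add: f_def divide_le_0_iff)
  have "continuous_on {0..1} f"
    unfolding f_def using s by (intro continuous_intros) auto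
  then obtain n where n: "\<And>x. x \<in> {0..1} \<Longrightarrow> \<bar>f x - (\<Sum>k\<le>n. f (k / n) * Bernstein n k x)\<bar> < \<eta>"
    using Bernstein_Weierstrass[OF _ \<eta>] by (meson order_refl)
  define G where "G t = \<eta> + (\<Sum>k\<le>n. f (k / n) * Bernstein n k ((sin (pi * t))\<^sup>2))" for t
  obtain c where c: "\<And>t. of_real (G t) = (\<Sum>i\<le>2 * n. c i * cis (2 * pi * (real i - real n) * t))"
    using bernstein_sin_squared_trig[where b = \<eta> and n = n and a = "\<lambda>k. f (k / n)"] unfolding G_def by blast
  have "(sin (pi * t))\<^sup>2 \<in> {0..1}" for t by (simp add: abs_square_le_1)
  hence Gf: "f ((sin (pi * t))\<^sup>2) < G t" "G t < f ((sin (pi * t))\<^sup>2) + 2 * \<eta>" for t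
    using n[of "(sin (pi * t))\<^sup>2"] unfolding G_def by (auto simp: abs_less_iff)
  have G0: "0 \<le> G t" for t using Gf(1)[of t] f01(1)[of "(sin (pi * t))\<^sup>2"] by linarith
  have G1: "1 \<le> G t" if "\<bar>t - 1/2 - of_int m\<bar> \<le> r" for t and m :: int
    using sin_squared_near_half[OF that] r f1[of "(sin (pi * t))\<^sup>2"] Gf(1)[of t] by (simp add: s1_def)
  \<comment> \<open>The first bound makes the average of \<open>q\<close> samples equal to the
    constant coefficient, the second gives \<open>1 / q \<le> \<eta>\<close>.\<close>
  define q where "q = max (2 * n + 1) (nat \<lceil>1 / \<eta>\<rceil>)"
  have q: "q > 2 * n" "real q > 0" by (auto simp: q_def)
  have "1 / \<eta> \<le> real q" unfolding q_def by linarith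
  hence q\<eta>: "1 / real q \<le> \<eta>" using \<eta> q by (simp add: field_simps)
  define c0 where "c0 = (\<Sum>j<q. G (real j / real q)) / real q"
  have "of_nat q * c n = of_real (\<Sum>j<q. G (real j / real q))"
    using trig_coeff_0_eq_average[OF q(1), of c] by (simp add: c)
  hence cn: "c n = of_real c0" using q(2) by (simp add: c0_def field_simps)
  have c00: "0 \<le> c0" unfolding c0_def by (intro divide_nonneg_nonneg sum_nonneg G0) auto
  \<comment> \<open>Sample points within \<open>\<rho>\<close> of 1/2, at most
    \<open>2 * \<rho> * q + 1\<close> of them. At all others the ramp is 0 and \<open>G\<close>
    stays below \<open>2 * \<eta>\<close>.\<close>
  let ?J = "{j::nat. real q * (1/2 - \<rho>) \<le> real j \<and> real j \<le> real q * (1/2 + \<rho>)}"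
  have intv: "real q * (1/2 - \<rho>) \<le> real q * (1/2 + \<rho>)" using r \<rho> by (intro mult_left_mono) auto
  have "(\<Sum>j<q. G (real j / real q)) \<le> (\<Sum>j<q. 2 * \<eta> + (if j \<in> ?J then 1 else 0))"
  proof (rule sum_mono)
    fix j assume j: "j \<in> {..<q}"
    show "G (real j / real q) \<le> 2 * \<eta> + (if j \<in> ?J then 1 else 0)"
    proof (cases "j \<in> ?J")
      case True
      thus ?thesis using Gf(2)[of "real j / real q"] f01(2)[of "(sin (pi * (real j / real q)))\<^sup>2"] by simp
    next
      case False
      have "\<rho> \<le> \<bar>real j / real q - 1/2\<bar>"
      proof (rule ccontr)
        assume "\<not> \<rho> \<le> \<bar>real j / real q - 1/2\<bar>"
        hence "1/2 - \<rho> \<le> real j / real q" "real j / real q \<le> 1/2 + \<rho>" by linarith+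
        hence "j \<in> ?J" using pos_le_divide_eq[OF q(2)] pos_divide_le_eq[OF q(2)] by (simp add: mult.commute)
        thus False using False by contradiction
      qed
      hence "(sin (pi * (real j / real q)))\<^sup>2 \<le> s0"
        unfolding s0_def using j \<rho> r by (intro sin_squared_away_half) auto
      thus ?thesis using Gf(2)[of "real j / real q"] f0 False by simp
    qed
  qed
  also have "\<dots> = 2 * \<eta> * real q + real (card ({..<q} \<inter> ?J))"
    by (simp add: sum.distrib sum.If_cases)
  also have "\<dots> \<le> 2 * \<eta> * real q + real (card ?J)"
    using card_nat_in_interval_le(1)[OF intv] by (intro add_left_mono of_nat_mono card_mono) auto
  also have "\<dots> \<le> 2 * \<eta> * real q + (2 * \<rho> * real q + 1)"
    using card_nat_in_interval_le(2)[OF intv] by (simp add: algebra_simps)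
  finally have "c0 \<le> 2 * \<eta> + 2 * \<rho> + 1 / real q"
    using q(2) by (simp add: c0_def field_simps)
  also have "\<dots> \<le> 2 * r + \<epsilon>" using q\<eta> \<rho>(3) \<eta> by (simp add: \<eta>_def)
  finally have "c0 \<le> 2 * r + \<epsilon>" .
  thus ?thesis using c G0 G1 cn c00 by blast
qed

text \<open>Nonnegative majorants may be multiplied: their product is at least 1 on the box and
  nonnegative elsewhere, and its mean is the product of the constant coefficients. The shifts
  \<open>\<phi>\<close> bring all arcs to the centre 1/2.\<close>

lemma weyl_upper_bound:
  fixes F :: "'a set" and \<theta> \<phi> r :: "'a \<Rightarrow> real"
  assumes F: "finite F"
    and indep: "\<And>h :: 'a \<Rightarrow> int. \<exists>x\<in>F. h x \<noteq> 0 \<Longrightarrow> (\<Sum>x\<in>F. of_int (h x) * \<theta> x) \<notin> \<int>"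
    and r: "\<And>x. x \<in> F \<Longrightarrow> 0 \<le> r x" "\<And>x. x \<in> F \<Longrightarrow> r x < 1/2" and \<epsilon>: "\<epsilon> > 0"
  shows "\<forall>\<^sub>F N in sequentially.
    real (card {n\<in>{1..N}. \<forall>x\<in>F. \<exists>m::int. \<bar>real n * \<theta> x + \<phi> x - 1/2 - of_int m\<bar> \<le> r x})
      \<le> ((\<Prod>x\<in>F. 2 * r x) + \<epsilon>) * real N"
proof -
  \<comment> \<open>Continuity at 0 yields one tolerance \<open>\<eta>\<close> per factor that costs
    less than \<open>\<epsilon>\<close> in the whole product.\<close>
  have "((\<lambda>\<eta>. \<Prod>x\<in>F. 2 * r x + \<eta>) \<longlongrightarrow> (\<Prod>x\<in>F. 2 * r x + 0)) (at_right 0)"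
    by (intro tendsto_intros)
  hence "\<forall>\<^sub>F \<eta> in at_right 0. (\<Prod>x\<in>F. 2 * r x + \<eta>) < (\<Prod>x\<in>F. 2 * r x) + \<epsilon>"
    using \<epsilon> by (intro order_tendstoD) auto
  moreover have "\<forall>\<^sub>F \<eta> in at_right (0::real). \<eta> > 0" by (rule eventually_at_right_less)
  ultimately have "\<forall>\<^sub>F \<eta> in at_right 0. \<eta> > 0 \<and> (\<Prod>x\<in>F. 2 * r x + \<eta>) < (\<Prod>x\<in>F. 2 * r x) + \<epsilon>"
    by eventually_elim auto
  from eventually_happens'[OF trivial_limit_at_right_real this] obtain \<eta> where \<eta>: "\<eta> > 0" "(\<Prod>x\<in>F. 2 * r x + \<eta>) < (\<Prod>x\<in>F. 2 * r x) + \<epsilon>" by blast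
  define P where "P x M c G c0 \<longleftrightarrow>
    (\<forall>t. complex_of_real (G t) = (\<Sum>i\<le>2 * M. c i * cis (2 * pi * (real i - real M) * t))) \<and>
    (\<forall>t. 0 \<le> G t) \<and> (\<forall>t. (\<exists>m::int. \<bar>t - 1/2 - of_int m\<bar> \<le> r x) \<longrightarrow> 1 \<le> G t) \<and>
    c M = of_real c0 \<and> 0 \<le> c0 \<and> c0 \<le> 2 * r x + \<eta>" for x M c G c0
  have "\<forall>x\<in>F. \<exists>M c G c0. P x M c G c0"
    unfolding P_def using arc_majorant[OF r \<eta>(1)] by blast
  then obtain M c G c0 where "\<forall>x\<in>F. P x (M x) (c x) (G x) (c0 x)" by metis
  hence G: "\<And>x t. x \<in> F \<Longrightarrow> of_real (G x t) =
        (\<Sum>i\<le>2 * M x. c x i * cis (2 * pi * (real i - real (M x)) * t))"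
    and G0: "\<And>x t. x \<in> F \<Longrightarrow> 0 \<le> G x t"
    and G1: "\<And>x t m. x \<in> F \<Longrightarrow> \<bar>t - 1/2 - of_int m\<bar> \<le> r x \<Longrightarrow> 1 \<le> G x t"
    and c0: "\<And>x. x \<in> F \<Longrightarrow> c x (M x) = of_real (c0 x)" "\<And>x. x \<in> F \<Longrightarrow> 0 \<le> c0 x"
      "\<And>x. x \<in> F \<Longrightarrow> c0 x \<le> 2 * r x + \<eta>"
    unfolding P_def by blast+
  define H where "H n = (\<Prod>x\<in>F. G x (real n * \<theta> x + \<phi> x))" for n :: nat
  have "(\<lambda>N. of_real ((\<Sum>n\<in>{1..N}. H n) / real N) :: complex) \<longlonglongrightarrow> of_real (\<Prod>x\<in>F. c0 x)"
    using trig_product_mean[OF F indep, of c M \<phi>] by (simp add: H_def c0(1) G cong: prod.cong)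
  hence "(\<lambda>N. (\<Sum>n\<in>{1..N}. H n) / real N) \<longlonglongrightarrow> (\<Prod>x\<in>F. c0 x)"
    by (simp only: tendsto_of_real_iff)
  moreover have "(\<Prod>x\<in>F. c0 x) \<le> (\<Prod>x\<in>F. 2 * r x + \<eta>)"
    using c0 by (intro prod_mono) auto
  hence "(\<Prod>x\<in>F. c0 x) < (\<Prod>x\<in>F. 2 * r x) + \<epsilon>" using \<eta>(2) by linarith
  ultimately have "\<forall>\<^sub>F N in sequentially. (\<Sum>n\<in>{1..N}. H n) / real N < (\<Prod>x\<in>F. 2 * r x) + \<epsilon>"
    by (rule order_tendstoD(2))
  thus ?thesis using eventually_gt_at_top[of 0]
  proof eventually_elim
    case (elim N)
    let ?S = "{n\<in>{1..N}. \<forall>x\<in>F. \<exists>m::int. \<bar>real n * \<theta> x + \<phi> x - 1/2 - of_int m\<bar> \<le> r x}"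
    have "real (card ?S) = (\<Sum>n\<in>?S. 1)" by simp
    also have "\<dots> \<le> (\<Sum>n\<in>?S. H n)"
    proof (rule sum_mono)
      fix n assume n: "n \<in> ?S"
      show "1 \<le> H n" unfolding H_def using n G1 by (intro prod_ge_1) blast
    qed
    also have "\<dots> \<le> (\<Sum>n\<in>{1..N}. H n)"
      by (intro sum_mono2) (auto simp: H_def intro!: prod_nonneg G0)
    also have "\<dots> \<le> ((\<Prod>x\<in>F. 2 * r x) + \<epsilon>) * real N"
      using elim by (simp add: field_simps)
    finally show ?case .
  qed
qed

text \<open>
  Upper bounds suffice, since the volumes of the parts add up to 1. This spares us minorants of indicator
  functions, whose products would not be minorants.
\<close>
lemma partition_density:
  fixes S :: "'a \<Rightarrow> nat set" and v :: "'a \<Rightarrow> real"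
  assumes U: "finite U" and v: "(\<Sum>u\<in>U. v u) = 1"
    and cover: "\<And>n. n \<ge> 1 \<Longrightarrow> \<exists>u\<in>U. n \<in> S u"
    and upper: "\<And>u \<epsilon>. u \<in> U \<Longrightarrow> \<epsilon> > 0 \<Longrightarrow>
      \<forall>\<^sub>F N in sequentially. real (card {n\<in>{1..N}. n \<in> S u}) \<le> (v u + \<epsilon>) * real N"
    and u: "u \<in> U"
  shows "(\<lambda>N. real (card {n\<in>{1..N}. n \<in> S u}) / real N) \<longlonglongrightarrow> v u"
proof (rule tendstoI)
  fix e :: real assume e: "e > 0"
  \<comment> \<open>The lower bound for the part \<open>u\<close> is 1 minus the upper bounds of the
    other \<open>card U - 1\<close> parts, so their tolerances must add up to less than
    \<open>e\<close>.\<close>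
  define \<epsilon> where "\<epsilon> = e / (2 * real (card U))"
  have cU: "card U \<ge> 1" using U u by (metis One_nat_def Suc_leI card_gt_0_iff empty_iff)
  have \<epsilon>: "\<epsilon> > 0" using e cU by (simp add: \<epsilon>_def)
  have \<epsilon>le: "\<epsilon> \<le> e / 2" using e cU by (simp add: \<epsilon>_def field_simps)
  have \<epsilon>c: "real (card U) * \<epsilon> = e / 2" using cU by (simp add: \<epsilon>_def)
  have "\<forall>\<^sub>F N in sequentially. \<forall>u\<in>U. real (card {n\<in>{1..N}. n \<in> S u}) \<le> (v u + \<epsilon>) * real N"
    using U upper \<epsilon> by (simp add: eventually_ball_finite_distrib)
  thus "\<forall>\<^sub>F N in sequentially. dist (real (card {n\<in>{1..N}. n \<in> S u}) / real N) (v u) < e"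
    using eventually_gt_at_top[of 0]
  proof eventually_elim
    case (elim N)
    define C where "C u = real (card {n\<in>{1..N}. n \<in> S u})" for u
    have Cle: "C u \<le> (v u + \<epsilon>) * real N" if "u \<in> U" for u using elim that by (simp add: C_def)
    have "{1..N} = (\<Union>u\<in>U. {n\<in>{1..N}. n \<in> S u})" using cover by fastforce
    hence "card {1..N} = card (\<Union>u\<in>U. {n\<in>{1..N}. n \<in> S u})" by (rule arg_cong)
    also have "\<dots> \<le> (\<Sum>u\<in>U. card {n\<in>{1..N}. n \<in> S u})" by (rule card_UN_le[OF U])
    finally have "N \<le> (\<Sum>u\<in>U. card {n\<in>{1..N}. n \<in> S u})" by simp
    hence "real N \<le> real (\<Sum>u\<in>U. card {n\<in>{1..N}. n \<in> S u})" by (rule of_nat_mono)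
    hence "real N \<le> (\<Sum>u\<in>U. C u)" by (simp only: C_def of_nat_sum)
    also have "\<dots> = C u + (\<Sum>w\<in>U-{u}. C w)" using U u by (simp add: sum.remove)
    also have "(\<Sum>w\<in>U-{u}. C w) \<le> (\<Sum>w\<in>U-{u}. (v w + \<epsilon>) * real N)"
      by (intro sum_mono Cle) auto
    also have "\<dots> = ((\<Sum>w\<in>U-{u}. v w) + (real (card U) - 1) * \<epsilon>) * real N"
      using U u cU by (simp add: sum_distrib_right[symmetric] sum.distrib of_nat_diff)
    also have "(\<Sum>w\<in>U-{u}. v w) = 1 - v u" using v U u by (simp add: sum.remove[of U u])
    finally have lo: "real N \<le> C u + (1 - v u + (real (card U) - 1) * \<epsilon>) * real N" by simp
    have "C u / real N \<le> v u + \<epsilon>" using Cle[OF u] elim by (simp add: field_simps)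
    moreover have "v u - (real (card U) - 1) * \<epsilon> \<le> C u / real N"
      using lo elim by (simp add: field_simps)
    moreover have "(real (card U) - 1) * \<epsilon> < e" using \<epsilon>c e \<epsilon> by (simp add: left_diff_distrib)
    ultimately show ?case using \<epsilon>le e unfolding C_def by (simp add: dist_real_def abs_less_iff)
  qed
qed

section \<open>The arithmetic of full numbers\<close>

text \<open>For \<open>k \<ge> 2\<close> these are the numbers \<open>\<lambda> ^ k\<close> together
  with 1: an exponent \<open>k + i\<close> with \<open>1 \<le> i \<le> k - 1\<close> lies strictly
  between \<open>k\<close> and \<open>2 * k\<close>. Including 1 lets irrationality of a single
  \<lambda> be a case of irrationality of ratios.\<close>

definition reduced_full :: "nat \<Rightarrow> nat \<Rightarrow> bool" where
  "reduced_full k N \<longleftrightarrow> N > 0 \<and>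
    (\<forall>p. prime p \<longrightarrow> multiplicity p N = 0 \<or> (k < multiplicity p N \<and> multiplicity p N < 2 * k))"

lemma reduced_full_1: "reduced_full k 1"
  by (simp add: reduced_full_def)

text \<open>A k-th power does not change exponents modulo \<open>k\<close>, and the residue
  determines the exponent: 0 comes from 0, and a residue \<open>r > 0\<close> from
  \<open>k + r\<close>.\<close>

lemma reduced_full_unique:
  assumes "reduced_full k N" "reduced_full k M" "a > 0" "c > 0" "a ^ k * N = c ^ k * M"
  shows "N = M"
proof (rule multiplicity_eq_nat)
  show "N > 0" "M > 0" using assms by (auto simp: reduced_full_def)
  fix p :: nat assume p: "prime p"
  have "multiplicity p (a ^ k * N) = multiplicity p (c ^ k * M)" using assms(5) by simp
  hence "k * multiplicity p a + multiplicity p N = k * multiplicity p c + multiplicity p M"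
    using assms(1-4) p by (simp add: reduced_full_def prime_elem_multiplicity_mult_distrib
      prime_elem_multiplicity_power_distrib)
  hence mod: "multiplicity p N mod k = multiplicity p M mod k" by (metis mod_mult_self4)
  have *: "multiplicity p X = (if multiplicity p X mod k = 0 then 0 else k + multiplicity p X mod k)"
    if X: "reduced_full k X" for X
  proof (cases "multiplicity p X = 0")
    case False
    hence "k < multiplicity p X" "multiplicity p X < 2 * k" using X p by (auto simp: reduced_full_def)
    hence "multiplicity p X mod k = multiplicity p X - k" by (simp add: mod_if)
    thus ?thesis using \<open>k < multiplicity p X\<close> by simp
  qed auto
  show "multiplicity p N = multiplicity p M" using *[OF assms(1)] *[OF assms(2)] mod by metis
qed

text \<open>A rational ratio \<open>m / n\<close> would give \<open>n ^ k * N = m ^ k * M\<close>,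
  against \<open>reduced_full_unique\<close>.\<close>

lemma reduced_full_root_ratio_irrational:
  assumes "reduced_full k N" "reduced_full k M" "N \<noteq> M" "k > 0"
  shows "root k (real N) / root k (real M) \<notin> \<rat>"
proof
  assume "root k (real N) / root k (real M) \<in> \<rat>"
  moreover have pos: "N > 0" "M > 0" using assms by (auto simp: reduced_full_def)
  ultimately obtain m n :: nat where mn: "n \<noteq> 0" "\<bar>root k (real N) / root k (real M)\<bar> = real m / real n"
    using Rats_abs_nat_div_natE by metis
  have "root k (real N) / root k (real M) > 0" using pos assms(4) by simp
  with mn have eq: "root k (real N) / root k (real M) = real m / real n" by (metis abs_of_pos)
  have m: "m > 0" using eq \<open>root k (real N) / root k (real M) > 0\<close> by (cases "m = 0") auto
  have "(root k (real N) / root k (real M)) ^ k = (real m / real n) ^ k" using eq by simp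
  hence "real N / real M = real m ^ k / real n ^ k" using assms(4) by (simp add: power_divide)
  hence "real (n ^ k * N) = real (m ^ k * M)" using mn(1) pos by (simp add: field_simps)
  hence "n ^ k * N = m ^ k * M" by (simp only: of_nat_eq_iff)
  thus False using reduced_full_unique[OF assms(1,2)] mn(1) m assms(3) by blast
qed

text \<open>Squarefreeness lets a prime divide at most one \<open>b j\<close>, and only once, so its
  exponent is 0 or \<open>k + j\<close>.\<close>

lemma prod_reduced_full:
  fixes b :: "nat \<Rightarrow> nat"
  assumes b: "\<And>i. i \<in> {1..k-1} \<Longrightarrow> b i \<ge> 1" and sq: "squarefree (\<Prod>i\<in>{1..k-1}. b i)"
  shows "reduced_full k (\<Prod>i\<in>{1..k-1}. b i ^ (k + i))"
  unfolding reduced_full_def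
proof (intro conjI allI impI)
  show "0 < (\<Prod>i\<in>{1..k-1}. b i ^ (k + i))" using b by (intro prod_pos) (auto simp: Suc_le_eq)
  fix p :: nat assume p: "prime p"
  have b0: "0 \<notin> b ` {1..k-1}" "0 \<notin> (\<lambda>i. b i ^ (k + i)) ` {1..k-1}" using b by force+
  define m where "m i = multiplicity p (b i)" for i
  have "multiplicity p (\<Prod>i\<in>{1..k-1}. b i ^ (k + i)) = (\<Sum>i\<in>{1..k-1}. multiplicity p (b i ^ (k + i)))"
    using p b0 by (intro prime_elem_multiplicity_prod_distrib) auto
  also have "\<dots> = (\<Sum>i\<in>{1..k-1}. (k + i) * m i)"
  proof (intro sum.cong refl)
    fix i assume "i \<in> {1..k-1}"
    hence "b i \<noteq> 0" using b[of i] by auto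
    thus "multiplicity p (b i ^ (k + i)) = (k + i) * m i"
      using p by (simp add: m_def prime_elem_multiplicity_power_distrib)
  qed
  finally have mult: "multiplicity p (\<Prod>i\<in>{1..k-1}. b i ^ (k + i)) = (\<Sum>i\<in>{1..k-1}. (k + i) * m i)" .
  have "(\<Sum>i\<in>{1..k-1}. m i) = multiplicity p (\<Prod>i\<in>{1..k-1}. b i)"
    unfolding m_def using p b0 by (intro prime_elem_multiplicity_prod_distrib[symmetric]) auto
  also have "\<dots> \<le> 1" 
  proof -
    have "(\<Prod>i\<in>{1..k-1}. b i) \<noteq> 0" using b0(1) by (auto simp: image_iff)
    from squarefree_factorial_semiring''[OF this] show ?thesis using sq p by blast
  qed
  finally consider "(\<Sum>i\<in>{1..k-1}. m i) = 0" | "(\<Sum>i\<in>{1..k-1}. m i) = Suc 0" by linarith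
  thus "multiplicity p (\<Prod>i\<in>{1..k-1}. b i ^ (k + i)) = 0 \<or>
        k < multiplicity p (\<Prod>i\<in>{1..k-1}. b i ^ (k + i)) \<and>
        multiplicity p (\<Prod>i\<in>{1..k-1}. b i ^ (k + i)) < 2 * k"
  proof cases
    case 1
    thus ?thesis unfolding mult by simp
  next
    case 2
    then obtain j where j: "j \<in> {1..k-1}" "m j = 1" "\<forall>i\<in>{1..k-1}. i \<noteq> j \<longrightarrow> m i = 0"
      by (subst (asm) sum_eq_Suc0_iff) auto
    have "(\<Sum>i\<in>{1..k-1}. (k + i) * m i) = (\<Sum>i\<in>{1..k-1}. if i = j then k + i else 0)"
      using j by (intro sum.cong) auto
    also have "\<dots> = k + j" using j(1) by simp
    finally show ?thesis unfolding mult using j(1) by auto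
  qed
qed

lemma reduced_full_ge_2E:
  assumes "reduced_full k N" "N \<ge> 2"
  obtains p where "prime p" "k < multiplicity p N"
proof -
  obtain p where p: "prime p" "p dvd N" using assms(2) prime_factor_nat[of N] by auto
  hence "multiplicity p N > 0" using assms by (simp add: prime_multiplicity_gt_zero_iff reduced_full_def)
  thus ?thesis using p assms(1) that by (auto simp: reduced_full_def)
qed

lemma Lambda_set_eq:
  assumes k: "k \<ge> 2"
  shows "Lambda_set k = (\<lambda>N. root k (real N)) ` {N. reduced_full k N \<and> N \<ge> 2}"
proof (intro equalityI subsetI)
  fix x assume "x \<in> Lambda_set k"
  then obtain b where b: "x = root k (\<Prod>i\<in>{1..k-1}. real (b i) ^ (k + i))" "\<forall>i\<in>{1..k-1}. b i \<ge> (1::nat)"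
    "(\<Prod>i\<in>{1..k-1}. b i) \<ge> 2" "squarefree (\<Prod>i\<in>{1..k-1}. b i)"
    unfolding Lambda_set_def by blast
  define N where "N = (\<Prod>i\<in>{1..k-1}. b i ^ (k + i))"
  have "reduced_full k N" unfolding N_def using b by (intro prod_reduced_full) auto
  moreover have "(\<Prod>i\<in>{1..k-1}. b i) \<le> N"
    unfolding N_def using b(2) k by (intro prod_mono conjI self_le_power) auto
  hence "N \<ge> 2" using b(3) by linarith
  moreover have "x = root k (real N)" by (simp add: b(1) N_def)
  ultimately show "x \<in> (\<lambda>N. root k (real N)) ` {N. reduced_full k N \<and> N \<ge> 2}" by blast
next
  fix x assume "x \<in> (\<lambda>N. root k (real N)) ` {N. reduced_full k N \<and> N \<ge> 2}"
  then obtain N where N: "reduced_full k N" "N \<ge> 2" "x = root k (real N)" by blast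
  define P where "P = prime_factors N"
  define g where "g p = multiplicity p N - k" for p
  \<comment> \<open>The primes of exponent exactly \<open>k + i\<close>; grouping the factorization
    of \<open>N\<close> by exponent recovers the product form.\<close>
  define b where "b i = (\<Prod>p\<in>{p\<in>P. g p = i}. p)" for i
  have finP: "finite P" by (simp add: P_def)
  have pP: "prime p" if "p \<in> P" for p using that by (auto simp: P_def)
  have mP: "k < multiplicity p N" "multiplicity p N < 2 * k" if "p \<in> P" for p
  proof -
    have "multiplicity p N > 0" using that N by (simp add: P_def prime_factors_multiplicity)
    thus "k < multiplicity p N" "multiplicity p N < 2 * k"
      using N(1) pP[OF that] by (auto simp: reduced_full_def)
  qed
  have gP: "g ` P \<subseteq> {1..k-1}" using mP by (force simp: g_def)
  have "(\<Prod>i\<in>{1..k-1}. b i ^ (k + i)) = (\<Prod>i\<in>{1..k-1}. \<Prod>p\<in>{p\<in>P. g p = i}. p ^ multiplicity p N)"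
  proof (intro prod.cong refl)
    fix i
    show "b i ^ (k + i) = (\<Prod>p\<in>{p\<in>P. g p = i}. p ^ multiplicity p N)"
      unfolding b_def prod_power_distrib by (intro prod.cong refl) (use mP(1) in \<open>force simp: g_def\<close>)
  qed
  also have "\<dots> = (\<Prod>p\<in>P. p ^ multiplicity p N)"
    by (rule prod.group[OF finP _ gP]) simp
  also have "\<dots> = N"
    unfolding P_def using N by (intro prime_factorization_nat[symmetric]) auto
  finally have bN: "(\<Prod>i\<in>{1..k-1}. b i ^ (k + i)) = N" .
  have prodb: "(\<Prod>i\<in>{1..k-1}. b i) = \<Prod>P"
    unfolding b_def by (rule prod.group[OF finP _ gP]) simp
  have "squarefree (\<Prod>p\<in>P. p)"
    using pP by (intro squarefree_prod_coprime) (auto simp: primes_coprime squarefree_prime)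
  moreover have "\<Prod>P \<ge> 2"
  proof -
    obtain p where p: "prime p" "p dvd N" using N(2) prime_factor_nat[of N] by auto
    hence "p \<in> P" using N by (auto simp: P_def prime_factors_dvd)
    hence "p dvd \<Prod>P" using finP by (intro dvd_prodI) auto
    moreover have "\<Prod>P > 0" using pP by (intro prod_pos) (auto simp: prime_gt_0_nat)
    ultimately have "p \<le> \<Prod>P" by (rule dvd_imp_le)
    thus ?thesis using p(1) prime_ge_2_nat[of p] by linarith
  qed
  moreover have "b i \<ge> 1" for i
    unfolding b_def by (intro prod_ge_1) (auto dest!: pP prime_ge_1_nat)
  moreover have "x = root k (\<Prod>i\<in>{1..k-1}. real (b i) ^ (k + i))"
    using N(3) by (simp flip: bN)
  ultimately show "x \<in> Lambda_set k"
    unfolding Lambda_set_def using prodb by auto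
qed

text \<open>An exponent \<open>v = q * k + r\<close> of \<open>n\<close> with \<open>r > 0\<close>
  is split as \<open>(q - 1) * k + (k + r)\<close>, and k-fullness provides
  \<open>q \<ge> 1\<close>; for \<open>r = 0\<close> it goes entirely into \<open>a ^ k\<close>.
  Being no k-th power is the same as \<open>N \<noteq> 1\<close>.\<close>

lemma S_set_eq:
  assumes k: "k \<ge> 2"
  shows "S_set k = {a ^ k * N | a N. a \<ge> 1 \<and> reduced_full k N \<and> N \<ge> 2}"
proof (intro equalityI subsetI)
  fix n assume "n \<in> S_set k"
  hence n: "n \<ge> 1" "\<And>p. prime p \<Longrightarrow> p dvd n \<Longrightarrow> p ^ k dvd n" "\<And>a. n \<noteq> a ^ k"
    by (auto simp: S_set_def k_full_def)
  define P where "P = prime_factors n"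
  define v e where "v p = multiplicity p n" and "e p = (if v p mod k = 0 then 0 else k + v p mod k)" for p
  define N a where "N = (\<Prod>p\<in>P. p ^ e p)" and "a = (\<Prod>p\<in>P. p ^ ((v p - e p) div k))"
  have finP: "finite P" and pP: "\<And>p. p \<in> P \<Longrightarrow> prime p" by (auto simp: P_def)
  have ve: "v p = (v p - e p) div k * k + e p" if "p \<in> P" for p
  proof -
    have "p ^ k dvd n" using that n(2) by (auto simp: P_def)
    hence vk: "k \<le> v p" unfolding v_def using n(1) pP[OF that]
      by (subst (asm) power_dvd_iff_le_multiplicity) auto
    define q r where "q = v p div k" and "r = v p mod k"
    have vq: "v p = q * k + r" by (simp add: q_def r_def)
    have "q \<ge> 1" using vk k unfolding q_def by (simp add: div_greater_zero_iff Suc_le_eq)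
    then obtain q' where q': "q = Suc q'" by (cases q) auto
    show ?thesis
    proof (cases "r = 0")
      case True
      thus ?thesis using vq k by (simp add: e_def r_def[symmetric])
    next
      case False
      hence "e p = k + r" by (simp add: e_def r_def)
      moreover from this have "v p - e p = q' * k" using vq q' by simp
      ultimately show ?thesis using vq q' k by simp
    qed
  qed
  have "a ^ k * N = (\<Prod>p\<in>P. p ^ ((v p - e p) div k * k + e p))"
    unfolding N_def a_def by (simp add: prod_power_distrib prod.distrib[symmetric] power_add power_mult)
  also have "\<dots> = (\<Prod>p\<in>P. p ^ v p)" using ve by (intro prod.cong refl) simp
  also have "\<dots> = n"
    unfolding P_def v_def using n(1) by (intro prime_factorization_nat[symmetric]) auto
  finally have aN: "a ^ k * N = n" .
  have a1: "a \<ge> 1" using aN n(1) k by (cases "a = 0") (auto simp: zero_power)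
  have N0: "N > 0" using aN n(1) by (cases "N = 0") auto
  have "reduced_full k N"
    unfolding reduced_full_def
  proof (intro conjI allI impI N0)
    fix p :: nat assume p: "prime p"
    have "multiplicity p N = (if p \<in> P then e p else 0)"
      unfolding N_def using finP pP p by (intro multiplicity_prod_prime_powers) auto
    thus "multiplicity p N = 0 \<or> (k < multiplicity p N \<and> multiplicity p N < 2 * k)"
      using k by (auto simp: e_def)
  qed
  moreover have "N \<noteq> 1" using aN n(3)[of a] by auto
  hence "N \<ge> 2" using N0 by linarith
  ultimately show "n \<in> {a ^ k * N | a N. a \<ge> 1 \<and> reduced_full k N \<and> N \<ge> 2}" using aN a1 by blast
next
  fix n assume "n \<in> {a ^ k * N | a N. a \<ge> 1 \<and> reduced_full k N \<and> N \<ge> 2}"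
  then obtain a N where aN: "n = a ^ k * N" "a \<ge> 1" "reduced_full k N" "N \<ge> 2" by blast
  have n1: "n \<ge> 1" using aN by (simp add: Suc_le_eq)
  have "p ^ k dvd n" if p: "prime p" "p dvd n" for p
  proof (cases "p dvd a")
    case True
    thus ?thesis using aN(1) by (simp add: dvd_power_same)
  next
    case False
    hence "p dvd N" using p aN(1) by (meson prime_dvd_multD prime_dvd_power)
    hence "multiplicity p N > 0" using aN p by (simp add: prime_multiplicity_gt_zero_iff)
    hence "k \<le> multiplicity p N" using aN(3) p by (auto simp: reduced_full_def)
    hence "p ^ k dvd N" by (rule multiplicity_dvd')
    thus ?thesis using aN(1) by simp
  qed
  moreover have "n \<noteq> c ^ k" for c
  proof
    assume "n = c ^ k"
    hence "a ^ k * N = c ^ k * 1" using aN(1) by simp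
    moreover have "c > 0" using \<open>n = c ^ k\<close> n1 k by (cases "c = 0") (auto simp: zero_power)
    ultimately have "a ^ k * N = c ^ k * 1" "c > 0" by auto
    hence "N = 1" using reduced_full_unique[OF aN(3) reduced_full_1, of a c] aN(2) by simp
    thus False using aN(4) by simp
  qed
  ultimately show "n \<in> S_set k" using n1 by (auto simp: S_set_def k_full_def)
qed


section \<open>Properties of the set of radicals \<lambda>\<close>

context
  fixes k :: nat
  assumes k2: "k \<ge> 2"
begin

lemma LambdaE:
  assumes "x \<in> Lambda_set k"
  obtains N where "reduced_full k N" "N \<ge> 2" "x = root k (real N)" "x ^ k = real N"
  using assms k2 that unfolding Lambda_set_eq[OF k2] by auto

text \<open>Some \<open>p ^ (k + 1)\<close> divides \<open>x ^ k\<close>, which therefore exceeds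
  \<open>2 ^ k\<close>. The strict bound separates the multiples of \<open>x\<close> by more than 2
  and makes \<open>1 - 2 / x\<close> positive.\<close>

lemma Lambda_gt_2:
  assumes "x \<in> Lambda_set k"
  shows "x > 2"
proof -
  obtain N where N: "reduced_full k N" "N \<ge> 2" "x = root k (real N)" using assms by (rule LambdaE)
  obtain p where p: "prime p" "k < multiplicity p N" using N(1,2) by (rule reduced_full_ge_2E)
  have "(2::nat) ^ k < 2 ^ (k + 1)" by simp
  also have "\<dots> \<le> p ^ (k + 1)" using prime_ge_2_nat[OF p(1)] by (intro power_mono) auto
  also have "\<dots> \<le> N"
    using N(2) p(2) by (intro dvd_imp_le[OF multiplicity_dvd'[of "k + 1" p N]]) auto
  finally have "real (2 ^ k) < real N" by (simp only: of_nat_less_iff)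
  hence "root k (2 ^ k) < root k (real N)" using k2 by simp
  moreover have "root k (2 ^ k) = (2 :: real)" using k2 by (intro real_root_power_cancel) auto
  ultimately show ?thesis using N(3) by simp
qed

lemma Lambda_nonneg: "x \<in> Lambda_set k \<Longrightarrow> 0 \<le> x"
  using Lambda_gt_2[of x] by simp

lemma Lambda_irrational:
  assumes "x \<in> Lambda_set k"
  shows "x \<notin> \<rat>"
proof -
  obtain N where N: "reduced_full k N" "N \<ge> 2" "x = root k (real N)" using assms by (rule LambdaE)
  thus ?thesis using reduced_full_root_ratio_irrational[OF N(1) reduced_full_1[of k]] k2 by auto
qed

lemma Lambda_ratio_irrational:
  assumes "x \<in> Lambda_set k" "y \<in> Lambda_set k" "x \<noteq> y"
  shows "x / y \<notin> \<rat>"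
proof -
  obtain N where N: "reduced_full k N" "N \<ge> 2" "x = root k (real N)" using assms(1) by (rule LambdaE)
  obtain M where M: "reduced_full k M" "M \<ge> 2" "y = root k (real M)" using assms(2) by (rule LambdaE)
  show ?thesis using reduced_full_root_ratio_irrational[OF N(1) M(1)] N M assms(3) k2 by auto
qed

text \<open>Roots of \<open>p ^ (k + 1)\<close> for primes \<open>p\<close> suffice. This provides
  disjoint \<open>I\<close> and \<open>J\<close> of every prescribed size, hence a positive density
  for all \<open>l\<close> and \<open>m\<close>.\<close>

lemma infinite_Lambda: "infinite (Lambda_set k)"
proof -
  have "p ^ (k + 1) \<in> {N. reduced_full k N \<and> N \<ge> 2}" if p: "prime p" for p :: nat
  proof -
    have "multiplicity q (p ^ (k + 1)) = (if q = p then k + 1 else 0)" if "prime q" for q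
      using p that prime_multiplicity_other[of q p]
      by (auto simp: multiplicity_same_power prime_elem_multiplicity_power_distrib simp del: power_Suc)
    moreover have "p ^ 1 \<le> p ^ (k + 1)" using prime_ge_1_nat[OF p] by (intro power_increasing) auto
    hence "p ^ (k + 1) \<ge> 2" using prime_ge_2_nat[OF p] by (metis order_trans power_one_right)
    moreover have "p ^ (k + 1) > 0" using prime_gt_0_nat[OF p] by simp
    ultimately show ?thesis using k2 by (auto simp: reduced_full_def simp del: power_Suc)
  qed
  hence "(\<lambda>p. root k (real (p ^ (k + 1)))) ` {p. prime p} \<subseteq> Lambda_set k"
    unfolding Lambda_set_eq[OF k2] by blast
  moreover have "inj_on (\<lambda>p::nat. root k (real (p ^ (k + 1)))) {p. prime p}"
    using k2 by (intro inj_onI) (auto simp del: power_Suc simp: power_eq_iff_eq_base)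
  hence "infinite ((\<lambda>p. root k (real (p ^ (k + 1)))) ` {p::nat. prime p})"
    using primes_infinite finite_imageD by blast
  ultimately show ?thesis using finite_subset by blast
qed

text \<open>Multiplying by some \<mu> with \<open>h \<mu> \<noteq> 0\<close> turns the relation into
  the rational constant \<open>h \<mu>\<close> plus rational multiples of the irrational radicals
  \<mu> and \<open>\<mu> / x\<close>, so that constant would be 0.\<close>

lemma Lambda_inverses_independent:
  assumes F: "finite F" "F \<subseteq> Lambda_set k" and h: "\<exists>x\<in>F. (h :: real \<Rightarrow> int) x \<noteq> 0"
  shows "(\<Sum>x\<in>F. of_int (h x) * (1 / x)) \<notin> \<int>"
proof
  assume "(\<Sum>x\<in>F. of_int (h x) * (1 / x)) \<in> \<int>"
  then obtain z :: int where z: "(\<Sum>x\<in>F. of_int (h x) * (1 / x)) = of_int z" by (elim Ints_cases)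
  obtain \<mu> where \<mu>: "\<mu> \<in> F" "h \<mu> \<noteq> 0" using h by blast
  have \<mu>L: "\<mu> \<in> Lambda_set k" and \<mu>2: "\<mu> > 2" using \<mu> F Lambda_gt_2 by auto
  have x2: "x > 2" if "x \<in> F" for x using that F Lambda_gt_2 by blast
  define A where "A = (\<lambda>x. \<mu> / x) ` (F - {\<mu>})"
  \<comment> \<open>For \<open>a = \<mu> / x\<close> the quotient \<open>\<mu> / a\<close> gives
    back \<open>x\<close>; the value at \<mu> carries the integer \<open>z\<close>. The two cases do
    not collide, since no \<open>x\<close> equals 1.\<close>
  define c :: "real \<Rightarrow> rat" where "c x = (if x = \<mu> then - of_int z else of_int (h (\<mu> / x)))" for x
  have powk: "x ^ k \<in> \<rat>" if "x \<in> Lambda_set k" for x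
    using that by (elim LambdaE) auto
  have \<mu>A: "\<mu> \<notin> A"
  proof
    assume "\<mu> \<in> A"
    then obtain x where "x \<in> F" "\<mu> = \<mu> / x" by (auto simp: A_def)
    thus False using x2[of x] \<mu>2 by (simp add: field_simps)
  qed
  have "of_rat (of_int (h \<mu>)) + (\<Sum>a\<in>insert \<mu> A. of_rat (c a) * a) = (0::real)"
  proof -
    have "(\<Sum>a\<in>A. of_rat (c a) * a) = (\<Sum>x\<in>F-{\<mu>}. of_rat (c (\<mu> / x)) * (\<mu> / x))"
      unfolding A_def by (rule sum.reindex[unfolded o_def]) (use \<mu>2 in \<open>auto simp: inj_on_def\<close>)
    also have "\<dots> = (\<Sum>x\<in>F-{\<mu>}. \<mu> * (of_int (h x) * (1 / x)))"
    proof (rule sum.cong[OF refl])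
      fix x assume x: "x \<in> F - {\<mu>}"
      hence "\<mu> / x \<in> A" by (auto simp: A_def)
      hence "\<mu> / x \<noteq> \<mu>" using \<mu>A by auto
      thus "of_rat (c (\<mu> / x)) * (\<mu> / x) = \<mu> * (of_int (h x) * (1 / x))"
        using \<mu>2 by (simp add: c_def)
    qed
    also have "\<dots> = \<mu> * (\<Sum>x\<in>F-{\<mu>}. of_int (h x) * (1 / x))" by (simp add: sum_distrib_left)
    also have "(\<Sum>x\<in>F-{\<mu>}. of_int (h x) * (1 / x)) = of_int z - of_int (h \<mu>) / \<mu>"
      using z F(1) \<mu>(1) by (simp add: sum.remove)
    also have "\<mu> * (of_int z - of_int (h \<mu>) / \<mu>) = \<mu> * of_int z - of_int (h \<mu>)"
      using \<mu>2 by (simp add: right_diff_distrib)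
    finally have "(\<Sum>a\<in>A. of_rat (c a) * a) = \<mu> * of_int z - of_int (h \<mu>)" .
    moreover have "finite A" using F by (simp add: A_def)
    ultimately show ?thesis using \<mu>A by (simp add: c_def of_rat_minus)
  qed
  moreover have "a > 0 \<and> a ^ k \<in> \<rat> \<and> a \<notin> \<rat>" if "a \<in> insert \<mu> A" for a
  proof (cases "a = \<mu>")
    case True
    thus ?thesis using \<mu>2 powk \<mu>L Lambda_irrational by auto
  next
    case False
    hence "a \<in> A" using that by simp
    then obtain x where x: "x \<in> F" "x \<noteq> \<mu>" "a = \<mu> / x" by (auto simp: A_def)
    thus ?thesis using \<mu>2 x2[of x] powk[of x] powk[OF \<mu>L] Lambda_ratio_irrational[OF \<mu>L, of x] F(2)
      by (auto simp: power_divide)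
  qed
  moreover have "finite (insert \<mu> A)" using F by (simp add: A_def)
  ultimately have "(of_int (h \<mu>) :: rat) = 0"
    using k2 by (intro radical_relation_const_eq_0[of "insert \<mu> A" k]) auto
  thus False using \<mu>(2) by simp
qed

text \<open>Each \<open>1 / x\<close> is a product of \<open>b i\<close> to the power
  \<open>-(1 + i / k)\<close>. Without squarefreeness the sum is bounded by a product of zeta values
  at \<open>1 + i / k\<close>, and these exponents exceed 1.\<close>

lemma Lambda_inverse_summable: "(\<lambda>x. 1 / x) summable_on Lambda_set k"
proof (rule nonneg_bdd_above_summable_on)
  show "1 / x \<ge> 0" if "x \<in> Lambda_set k" for x using Lambda_gt_2[OF that] by simp
  let ?I = "{1..k-1}"
  \<comment> \<open>At \<open>n = 0\<close> this is 0, because \<open>0 powr\<close> anything is 0;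
    the series and the sums over \<open>{..M}\<close> may thus start at 0.\<close>
  define w where "w i n = real n powr (- (1 + real i / real k))" for i n :: nat
  have sw: "summable (w i)" if "i \<in> ?I" for i
    unfolding w_def using that k2 by (subst summable_real_powr_iff) auto
  have wn: "w i n \<ge> 0" for i n by (simp add: w_def)
  define C where "C = (\<Prod>i\<in>?I. suminf (w i))"
  have "sum (\<lambda>x. 1 / x) X \<le> C" if X: "X \<subseteq> Lambda_set k" "finite X" for X
  proof -
    \<comment> \<open>Extensional choices place each \<open>b x\<close> in a \<open>PiE\<close> box;
      they are injective in \<open>x\<close> because \<open>b x\<close> determines
      \<open>x\<close>.\<close>
    have "\<forall>x\<in>X. \<exists>b. b \<in> extensional ?I \<and> (\<forall>i\<in>?I. b i \<ge> (1::nat)) \<and>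
        x = root k (\<Prod>i\<in>?I. real (b i) ^ (k + i))"
    proof
      fix x assume "x \<in> X"
      hence "x \<in> Lambda_set k" using X by blast
      then obtain b where "x = root k (\<Prod>i\<in>?I. real (b i) ^ (k + i))" "\<forall>i\<in>?I. b i \<ge> (1::nat)"
        unfolding Lambda_set_def by blast
      thus "\<exists>b. b \<in> extensional ?I \<and> (\<forall>i\<in>?I. b i \<ge> (1::nat)) \<and>
          x = root k (\<Prod>i\<in>?I. real (b i) ^ (k + i))"
        by (intro exI[of _ "restrict b ?I"]) auto
    qed
    then obtain b where b: "\<And>x. x \<in> X \<Longrightarrow> b x \<in> extensional ?I"
      "\<And>x i. x \<in> X \<Longrightarrow> i \<in> ?I \<Longrightarrow> b x i \<ge> (1::nat)"
      "\<And>x. x \<in> X \<Longrightarrow> x = root k (\<Prod>i\<in>?I. real (b x i) ^ (k + i))"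
      by metis
    define M where "M = Max (insert 0 ((\<lambda>(x, i). b x i) ` (X \<times> ?I)))"
    have bM: "b x i \<le> M" if "x \<in> X" "i \<in> ?I" for x i
      unfolding M_def using X that by (intro Max_ge) auto
    have inv: "1 / x = (\<Prod>i\<in>?I. w i (b x i))" if x: "x \<in> X" for x
    proof -
      have "0 < (\<Prod>i\<in>?I. real (b x i) ^ (k + i))"
      proof (rule prod_pos)
        fix i assume "i \<in> ?I"
        hence "b x i > 0" using b(2)[OF x, of i] by linarith
        thus "0 < real (b x i) ^ (k + i)" by simp
      qed
      hence "x = (\<Prod>i\<in>?I. real (b x i) ^ (k + i)) powr (1 / real k)"
        using b(3)[OF x] k2 root_powr_inverse by force
      also have "\<dots> = (\<Prod>i\<in>?I. (real (b x i) ^ (k + i)) powr (1 / real k))"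
        by (rule prod_powr_distrib)
      also have "\<dots> = (\<Prod>i\<in>?I. inverse (w i (b x i)))"
      proof (intro prod.cong refl)
        fix i assume i: "i \<in> ?I"
        have "real (b x i) > 0" using b(2)[OF x i] by simp
        hence "(real (b x i) ^ (k + i)) powr (1 / real k) = real (b x i) powr (real (k + i) * (1 / real k))"
          by (simp add: powr_powr flip: powr_realpow del: of_nat_add)
        also have "real (k + i) * (1 / real k) = 1 + real i / real k" using k2 by (simp add: field_simps)
        finally show "(real (b x i) ^ (k + i)) powr (1 / real k) = inverse (w i (b x i))"
          by (simp only: w_def powr_minus inverse_inverse_eq)
      qed
      also have "\<dots> = inverse (\<Prod>i\<in>?I. w i (b x i))" by (simp add: prod_inversef[unfolded o_def])
      finally show ?thesis by (metis inverse_inverse_eq inverse_eq_divide)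
    qed
    have "inj_on b X" using b(3) by (intro inj_onI) metis
    have "(\<Sum>x\<in>X. 1 / x) = (\<Sum>x\<in>X. \<Prod>i\<in>?I. w i (b x i))" using inv by (intro sum.cong) auto
    also have "\<dots> = (\<Sum>e\<in>b ` X. \<Prod>i\<in>?I. w i (e i))"
      using \<open>inj_on b X\<close> by (subst sum.reindex) auto
    also have "\<dots> \<le> (\<Sum>e\<in>(\<Pi>\<^sub>E i\<in>?I. {..M}). \<Prod>i\<in>?I. w i (e i))"
    proof (rule sum_mono2)
      show "finite (\<Pi>\<^sub>E i\<in>?I. {..M})" by (intro finite_PiE) auto
      show "b ` X \<subseteq> (\<Pi>\<^sub>E i\<in>?I. {..M})"
      proof (rule image_subsetI)
        fix x assume x: "x \<in> X"
        show "b x \<in> (\<Pi>\<^sub>E i\<in>?I. {..M})" using b(1)[OF x] bM[OF x] by (simp add: PiE_iff)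
      qed
    qed (auto intro!: prod_nonneg wn)
    also have "\<dots> = (\<Prod>i\<in>?I. \<Sum>n\<le>M. w i n)" by (rule prod_sum_PiE[symmetric]) auto
    also have "\<dots> \<le> C"
      unfolding C_def
      by (intro prod_mono conjI sum_nonneg wn sum_le_suminf sw) (auto simp: wn)
    finally show ?thesis .
  qed
  thus "bdd_above (sum (\<lambda>x. 1 / x) ` {X. X \<subseteq> Lambda_set k \<and> finite X})"
    by (intro bdd_aboveI[of _ C]) auto
qed

end

section \<open>Densities\<close>

text \<open>The value \<open>a = 0\<close> is excluded automatically by
  \<open>real n < real a * x\<close>.\<close>

definition hit :: "real \<Rightarrow> nat \<Rightarrow> bool" where
  "hit x n \<longleftrightarrow> (\<exists>a::nat. real n < real a * x \<and> real a * x < real n + 1)"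

definition hits :: "nat \<Rightarrow> nat \<Rightarrow> real set" where
  "hits k n = {x\<in>Lambda_set k. hit x n}"

lemma hit_exclusive:
  assumes "x > 2" "hit x n" "hit x (n + 1)"
  shows False
proof -
  obtain a b :: nat where ab: "real n < real a * x" "real a * x < real n + 1"
    "real n + 1 < real b * x" "real b * x < real n + 2"
    using assms(2,3) by (auto simp: hit_def add.commute)
  have "real a * x < real b * x" using ab by linarith
  hence "a < b" using assms(1) by simp
  hence "real a + 1 \<le> real b" by simp
  hence "(real a + 1) * x \<le> real b * x" using assms(1) by (intro mult_right_mono) auto
  thus False using ab assms(1) by (simp add: algebra_simps)
qed

lemma hit_less: 
  assumes "hit x n" "x > 0"
  shows "x < real n + 1"
proof -
  obtain a :: nat where a: "real n < real a * x" "real a * x < real n + 1" using assms by (auto simp: hit_def)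
  have "a \<noteq> 0" using a(1) by (cases "a = 0") auto
  hence "1 * x \<le> real a * x" using assms(2) by (intro mult_right_mono) auto
  thus ?thesis using a(2) by simp
qed

text \<open>A hit \<open>n\<close> is the floor of \<open>a * x\<close> minus \<open>j\<close>, so
  it suffices to count the possible \<open>a\<close>. These start at 1, which keeps the bound free
  of an additive constant; otherwise it could not be summed over infinitely many
  \<open>x\<close>.\<close>

lemma card_hit_shift_le:
  assumes x: "x > 0"
  shows "real (card {n\<in>{1..N}. hit x (n + j)}) \<le> (real N + real j + 1) / x"
proof -
  define K where "K = nat \<lfloor>(real N + real j + 1) / x\<rfloor>"
  have "{n\<in>{1..N}. hit x (n + j)} \<subseteq> (\<lambda>a. nat \<lfloor>real a * x\<rfloor> - j) ` {1..K}"
  proof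
    fix n assume "n \<in> {n\<in>{1..N}. hit x (n + j)}"
    then obtain a :: nat where n: "1 \<le> n" "n \<le> N" and a: "real (n + j) < real a * x" "real a * x < real (n + j) + 1"
      by (auto simp: hit_def)
    have "\<lfloor>real a * x\<rfloor> = int (n + j)" using a by linarith
    hence "n = nat \<lfloor>real a * x\<rfloor> - j" by simp
    moreover have "a \<noteq> 0" using a(1) by (cases "a = 0") auto
    moreover have "real a \<le> (real N + real j + 1) / x" using a(2) n x by (simp add: field_simps)
    hence "a \<le> K" unfolding K_def by (simp add: le_nat_floor)
    ultimately show "n \<in> (\<lambda>a. nat \<lfloor>real a * x\<rfloor> - j) ` {1..K}" by (auto simp: Suc_le_eq)
  qed
  hence "card {n\<in>{1..N}. hit x (n + j)} \<le> card ((\<lambda>a. nat \<lfloor>real a * x\<rfloor> - j) ` {1..K})"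
    by (intro card_mono) auto
  also have "\<dots> \<le> K" using card_image_le[of "{1..K}" "\<lambda>a. nat \<lfloor>real a * x\<rfloor> - j"] by simp
  finally have "real (card {n\<in>{1..N}. hit x (n + j)}) \<le> real K" by simp
  also have "\<dots> \<le> (real N + real j + 1) / x" unfolding K_def using x by (simp add: of_nat_floor)
  finally show ?thesis .
qed

lemma has_densityI:
  assumes lim: "(\<lambda>N. real (card {n\<in>{1..N}. n \<in> A}) / real N) \<longlonglongrightarrow> D" and A: "\<And>n. n \<in> A \<Longrightarrow> n \<ge> 1"
  shows "has_density A D"
proof -
  have fl: "filterlim (\<lambda>x::real. nat \<lfloor>x\<rfloor>) sequentially at_top"
    by (rule filterlim_compose[OF filterlim_nat_sequentially filterlim_floor_sequentially])
  have "((\<lambda>x::real. real (card {n\<in>{1..nat \<lfloor>x\<rfloor>}. n \<in> A}) / real (nat \<lfloor>x\<rfloor>) * (real (nat \<lfloor>x\<rfloor>) / x)) \<longlongrightarrow> D * 1) at_top"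
  proof (intro tendsto_mult filterlim_compose[OF lim fl])
    show "((\<lambda>x::real. real (nat \<lfloor>x\<rfloor>) / x) \<longlongrightarrow> 1) at_top"
      by real_asymp
  qed
  moreover have "\<forall>\<^sub>F x::real in at_top. real (card {n\<in>{1..nat \<lfloor>x\<rfloor>}. n \<in> A}) / real (nat \<lfloor>x\<rfloor>) * (real (nat \<lfloor>x\<rfloor>) / x)
      = real (card {n\<in>A. real n \<le> x}) / x"
    using eventually_ge_at_top[of 1]
  proof eventually_elim
    case (elim x)
    have "{n\<in>{1..nat \<lfloor>x\<rfloor>}. n \<in> A} = {n\<in>A. real n \<le> x}"
    proof (intro equalityI subsetI)
      fix n assume "n \<in> {n\<in>{1..nat \<lfloor>x\<rfloor>}. n \<in> A}"
      moreover from this have "real n \<le> x" using elim by (auto simp: le_nat_iff le_floor_iff)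
      ultimately show "n \<in> {n\<in>A. real n \<le> x}" by simp
    qed (use A in \<open>auto simp: le_nat_floor\<close>)
    moreover have "a / b * (b / x) = a / x" if "b \<noteq> 0" for a b :: real using that by simp
    moreover have "real (nat \<lfloor>x\<rfloor>) \<noteq> 0" using elim by linarith
    ultimately show ?case by (simp only:)
  qed
  ultimately show ?thesis unfolding has_density_def by (simp add: Lim_transform_eventually)
qed

text \<open>Exchange of the limits in \<open>N\<close> and in the cutoff \<open>M\<close>: the error
  \<open>\<tau> M\<close> must not depend on \<open>N\<close>.\<close>

lemma tendsto_uniform_approx:
  fixes f :: "nat \<Rightarrow> real" and g :: "real \<Rightarrow> nat \<Rightarrow> real"
  assumes g: "\<forall>\<^sub>F M in at_top. g M \<longlonglongrightarrow> d M"
    and fg: "\<forall>\<^sub>F M in at_top. \<forall>N\<ge>1. \<bar>f N - g M N\<bar> \<le> \<tau> M"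
    and d: "(d \<longlongrightarrow> D) at_top" and \<tau>: "(\<tau> \<longlongrightarrow> 0) at_top"
  shows "f \<longlonglongrightarrow> D"
proof (rule tendstoI)
  fix e :: real assume e: "e > 0"
  have "\<forall>\<^sub>F M in at_top. dist (d M) D < e / 3" "\<forall>\<^sub>F M in at_top. dist (\<tau> M) 0 < e / 3"
    using e tendstoD[OF d, of "e / 3"] tendstoD[OF \<tau>, of "e / 3"] by auto
  hence "\<forall>\<^sub>F M in at_top. dist (d M) D < e / 3 \<and> dist (\<tau> M) 0 < e / 3 \<and> g M \<longlonglongrightarrow> d M \<and>
      (\<forall>N\<ge>1. \<bar>f N - g M N\<bar> \<le> \<tau> M)"
    using g fg by eventually_elim auto
  then obtain M where M: "dist (d M) D < e / 3" "dist (\<tau> M) 0 < e / 3" "g M \<longlonglongrightarrow> d M"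
    "\<forall>N\<ge>1. \<bar>f N - g M N\<bar> \<le> \<tau> M"
    using eventually_happens'[OF trivial_limit_at_top_linorder] by blast
  have "\<forall>\<^sub>F N in sequentially. dist (g M N) (d M) < e / 3" using e tendstoD[OF M(3), of "e / 3"] by auto
  thus "\<forall>\<^sub>F N in sequentially. dist (f N) D < e"
    using eventually_ge_at_top[of 1]
  proof eventually_elim
    case (elim N)
    have "\<bar>f N - g M N\<bar> \<le> \<tau> M" using M(4) elim(2) by blast
    thus ?case using elim(1) M(1,2) unfolding dist_real_def by linarith
  qed
qed

context
  fixes k :: nat
  assumes k2: "k \<ge> 2"
begin

section \<open>Cutting off large \<lambda>\<close>

lemma finite_Lambda_le: "finite {x\<in>Lambda_set k. x \<le> M}"
proof -
  have "{x\<in>Lambda_set k. x \<le> M} \<subseteq> (\<lambda>N. root k (real N)) ` {..nat \<lfloor>M ^ k\<rfloor>}"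
  proof
    fix x assume x: "x \<in> {x\<in>Lambda_set k. x \<le> M}"
    then obtain N where N: "x = root k (real N)" "x ^ k = real N" by (auto elim: LambdaE[OF k2])
    have "x > 2" using x Lambda_gt_2[OF k2] by blast
    hence "x ^ k \<le> M ^ k" using x by (intro power_mono) auto
    hence "N \<le> nat \<lfloor>M ^ k\<rfloor>" using N(2) by (simp add: le_nat_floor)
    thus "x \<in> (\<lambda>N. root k (real N)) ` {..nat \<lfloor>M ^ k\<rfloor>}" using N(1) by blast
  qed
  thus ?thesis using finite_subset by blast
qed

text \<open>Turns unordered sums over all \<lambda> into limits over cutoffs
  \<open>x \<le> M\<close>, the order in which \<open>set_prod_lim\<close> takes its
  products.\<close>

lemma filterlim_Lambda_le:
  "filterlim (\<lambda>M. {x\<in>Lambda_set k. x \<le> M}) (finite_subsets_at_top (Lambda_set k)) at_top"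
  unfolding filterlim_finite_subsets_at_top
proof (intro allI impI)
  fix X assume X: "finite X \<and> X \<subseteq> Lambda_set k"
  have "\<forall>\<^sub>F M in at_top. \<forall>x\<in>X. x \<le> M"
    using X by (auto simp: eventually_ball_finite_distrib eventually_ge_at_top)
  thus "\<forall>\<^sub>F M in at_top. finite {x\<in>Lambda_set k. x \<le> M} \<and> X \<subseteq> {x\<in>Lambda_set k. x \<le> M} \<and>
      {x\<in>Lambda_set k. x \<le> M} \<subseteq> Lambda_set k"
    by eventually_elim (use X finite_Lambda_le in auto)
qed

definition tail :: "real \<Rightarrow> real" where
  "tail M = (\<Sum>\<^sub>\<infinity>x\<in>{x\<in>Lambda_set k. x > M}. 1 / x)"

lemma tail_summable: "(\<lambda>x. 1 / x) summable_on {x\<in>Lambda_set k. x > M}"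
  by (rule summable_on_subset_banach[OF Lambda_inverse_summable[OF k2]]) auto

lemma tail_nonneg: "tail M \<ge> 0"
  unfolding tail_def by (intro infsum_nonneg) (auto intro: Lambda_nonneg[OF k2])

lemma tail_tendsto_0: "(tail \<longlongrightarrow> 0) at_top"
proof -
  let ?s = "\<Sum>\<^sub>\<infinity>x\<in>Lambda_set k. 1 / x"
  have "((\<lambda>x. 1 / x) has_sum ?s) (Lambda_set k)"
    using Lambda_inverse_summable[OF k2] by (rule has_sum_infsum)
  hence "((\<lambda>M. \<Sum>x | x \<in> Lambda_set k \<and> x \<le> M. 1 / x) \<longlongrightarrow> ?s) at_top"
    unfolding has_sum_def by (rule filterlim_compose[OF _ filterlim_Lambda_le])
  hence "((\<lambda>M. ?s - (\<Sum>x | x \<in> Lambda_set k \<and> x \<le> M. 1 / x)) \<longlongrightarrow> ?s - ?s) at_top"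
    by (intro tendsto_intros)
  moreover have tail: "tail M = ?s - (\<Sum>x | x \<in> Lambda_set k \<and> x \<le> M. 1 / x)" for M
  proof -
    have "Lambda_set k = {x\<in>Lambda_set k. x \<le> M} \<union> {x\<in>Lambda_set k. x > M}" by auto
    hence "?s = infsum (\<lambda>x. 1 / x) ({x\<in>Lambda_set k. x \<le> M} \<union> {x\<in>Lambda_set k. x > M})" by simp
    also have "\<dots> = infsum (\<lambda>x. 1 / x) {x\<in>Lambda_set k. x \<le> M} + tail M"
      unfolding tail_def using finite_Lambda_le
      by (intro infsum_Un_disjoint tail_summable summable_on_finite[of "{x\<in>Lambda_set k. x \<le> M}"]) auto
    finally show ?thesis using finite_Lambda_le by simp
  qed
  have "tail = (\<lambda>M. ?s - (\<Sum>x | x \<in> Lambda_set k \<and> x \<le> M. 1 / x))" by (rule ext) (rule tail)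
  ultimately show ?thesis by (simp only: diff_self)
qed

lemma card_tail_hits_le:
  "real (card {n\<in>{1..N}. \<exists>x\<in>Lambda_set k. x > M \<and> (hit x n \<or> hit x (n + 1))})
    \<le> 2 * (real N + 2) * tail M"
proof -
  \<comment> \<open>A larger \<open>x\<close> has no positive multiple below \<open>N + 2\<close>,
    so the union bound runs over a finite set.\<close>
  define X where "X = {x\<in>Lambda_set k. x > M \<and> x \<le> real N + 2}"
  have finX: "finite X" unfolding X_def by (rule finite_subset[OF _ finite_Lambda_le[of "real N + 2"]]) auto
  have X2: "x > 2" if "x \<in> X" for x using that Lambda_gt_2[OF k2] by (auto simp: X_def)
  have "{n\<in>{1..N}. \<exists>x\<in>Lambda_set k. x > M \<and> (hit x n \<or> hit x (n + 1))} \<subseteq>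
      (\<Union>x\<in>X. {n\<in>{1..N}. hit x (n + 0)} \<union> {n\<in>{1..N}. hit x (n + 1)})"
  proof
    fix n assume "n \<in> {n\<in>{1..N}. \<exists>x\<in>Lambda_set k. x > M \<and> (hit x n \<or> hit x (n + 1))}"
    then obtain x where n: "n \<in> {1..N}" and x: "x \<in> Lambda_set k" "x > M" "hit x n \<or> hit x (n + 1)" by blast
    have "x > 0" using Lambda_gt_2[OF k2 x(1)] by simp
    hence "x < real N + 2" using x(3) n hit_less[of x n] hit_less[of x "n + 1"] by fastforce
    hence "x \<in> X" using x by (simp add: X_def)
    thus "n \<in> (\<Union>x\<in>X. {n\<in>{1..N}. hit x (n + 0)} \<union> {n\<in>{1..N}. hit x (n + 1)})" using x n by auto
  qed
  hence "card {n\<in>{1..N}. \<exists>x\<in>Lambda_set k. x > M \<and> (hit x n \<or> hit x (n + 1))} \<le>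
      card (\<Union>x\<in>X. {n\<in>{1..N}. hit x (n + 0)} \<union> {n\<in>{1..N}. hit x (n + 1)})"
    using finX by (intro card_mono) auto
  also have "\<dots> \<le> (\<Sum>x\<in>X. card ({n\<in>{1..N}. hit x (n + 0)} \<union> {n\<in>{1..N}. hit x (n + 1)}))"
    by (rule card_UN_le[OF finX])
  also have "\<dots> \<le> (\<Sum>x\<in>X. card {n\<in>{1..N}. hit x (n + 0)} + card {n\<in>{1..N}. hit x (n + 1)})"
    by (intro sum_mono card_Un_le)
  finally have "real (card {n\<in>{1..N}. \<exists>x\<in>Lambda_set k. x > M \<and> (hit x n \<or> hit x (n + 1))}) \<le>
      real (\<Sum>x\<in>X. card {n\<in>{1..N}. hit x (n + 0)} + card {n\<in>{1..N}. hit x (n + 1)})"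
    by (rule of_nat_mono)
  also have "\<dots> = (\<Sum>x\<in>X. real (card {n\<in>{1..N}. hit x (n + 0)}) + real (card {n\<in>{1..N}. hit x (n + 1)}))"
    by simp
  also have "\<dots> \<le> (\<Sum>x\<in>X. 2 * (real N + 2) * (1 / x))"
  proof (rule sum_mono)
    fix x assume x: "x \<in> X"
    hence "x > 0" using X2[of x] by simp
    have "real (card {n\<in>{1..N}. hit x (n + 0)}) \<le> (real N + real 0 + 1) / x"
      by (rule card_hit_shift_le) fact
    also have "\<dots> \<le> (real N + 2) / x" using \<open>x > 0\<close> by (intro divide_right_mono) auto
    finally have "real (card {n\<in>{1..N}. hit x (n + 0)}) \<le> (real N + 2) / x" .
    moreover have "real (card {n\<in>{1..N}. hit x (n + 1)}) \<le> (real N + real 1 + 1) / x"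
      by (rule card_hit_shift_le) fact
    ultimately show "real (card {n\<in>{1..N}. hit x (n + 0)}) + real (card {n\<in>{1..N}. hit x (n + 1)})
        \<le> 2 * (real N + 2) * (1 / x)" by (simp add: add_divide_distrib)
  qed
  also have "\<dots> = 2 * (real N + 2) * (\<Sum>x\<in>X. 1 / x)" by (simp add: sum_distrib_left)
  also have "(\<Sum>x\<in>X. 1 / x) \<le> tail M"
    unfolding tail_def
    by (intro finite_sum_le_infsum[OF tail_summable finX]) (auto simp: X_def intro: Lambda_nonneg[OF k2])
  finally show ?thesis by (simp add: mult_left_mono)
qed

lemma finite_hits: "finite (hits k n)"
proof (rule finite_subset[OF _ finite_Lambda_le])
  show "hits k n \<subseteq> {x\<in>Lambda_set k. x \<le> real n + 1}"
    using hit_less Lambda_gt_2[OF k2] by (force simp: hits_def)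
qed

lemma hits_disjoint: "hits k n \<inter> hits k (n + 1) = {}"
  using hit_exclusive Lambda_gt_2[OF k2] by (auto simp: hits_def)

section \<open>From k-th powers to multiples of \<lambda>\<close>

lemma power_between_iff:
  fixes y :: real
  assumes "y \<ge> 0"
  shows "real (n ^ k) < y ^ k \<longleftrightarrow> real n < y" "y ^ k < real (n ^ k) \<longleftrightarrow> y < real n"
  using assms k2 by (simp_all add: power_less_power_Suc power_mono_iff not_le[symmetric])

lemma S_ofE:
  assumes "s \<in> between (S_of k I) (n ^ k) (m ^ k)" "I \<subseteq> Lambda_set k"
  obtains a x where "a \<ge> 1" "x \<in> I" "real s = (real a * x) ^ k" "real n < real a * x" "real a * x < real m"
proof -
  obtain a x where ax: "a \<ge> 1" "x \<in> I" "real s = (real a * x) ^ k"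
    using assms(1) by (auto simp: between_def S_of_def power_mult_distrib)
  have "x > 2" using ax(2) assms(2) Lambda_gt_2[OF k2] by blast
  hence y: "real a * x \<ge> 0" by simp
  have "real (n ^ k) < real s" "real s < real (m ^ k)"
    using assms(1) by (simp_all only: between_def of_nat_less_iff mem_Collect_eq)
  thus ?thesis using that ax power_between_iff[OF y] by metis
qed

lemma S_ofI:
  assumes "x \<in> I" "I \<subseteq> Lambda_set k" "real n < real a * x" "real a * x < real m"
  obtains s where "s \<in> between (S_of k I) (n ^ k) (m ^ k)" "real s = (real a * x) ^ k"
proof -
  obtain N where N: "x ^ k = real N" using assms by (auto elim: LambdaE[OF k2])
  have "x > 2" using assms Lambda_gt_2[OF k2] by blast
  hence y: "real a * x \<ge> 0" by simp
  have a: "a \<ge> 1" using assms(3) by (cases a) auto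
  have s: "real (a ^ k * N) = (real a * x) ^ k" using N by (simp add: power_mult_distrib)
  have "real (n ^ k) < real (a ^ k * N)" "real (a ^ k * N) < real (m ^ k)"
    unfolding s using power_between_iff[OF y] assms by auto
  hence "a ^ k * N \<in> between (S_of k I) (n ^ k) (m ^ k)"
    unfolding between_def S_of_def of_nat_less_iff mem_Collect_eq using a assms(1)
    by (intro conjI exI[of _ a] bexI[of _ x]) (auto simp: N)
  thus ?thesis using s that by blast
qed

text \<open>Ensures that different radicals contribute different integers, so counting integers
  amounts to counting radicals.\<close>

lemma Lambda_multiple_unique:
  assumes "x \<in> Lambda_set k" "y \<in> Lambda_set k" "a \<ge> 1" "b \<ge> 1" "real a * x = real b * y"
  shows "x = y"
proof (rule ccontr)
  assume "x \<noteq> y"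
  hence "x / y \<notin> \<rat>" using Lambda_ratio_irrational[OF k2] assms by blast
  moreover have "x / y = real b / real a"
    using assms(3-5) Lambda_gt_2[OF k2 assms(2)] by (simp add: field_simps)
  ultimately show False by simp
qed

text \<open>Each hitting \<open>x\<close> contributes exactly one integer, since its multiples are
  more than 1 apart, and no integer comes from two radicals. \<open>I\<close> may be infinite, which
  is what the application to \<open>Lambda_set k\<close> requires.\<close>

lemma card_between_S_of:
  assumes I: "I \<subseteq> Lambda_set k"
  shows "card (between (S_of k I) (n ^ k) ((n + 1) ^ k)) = card {x\<in>I. hit x n}"
proof -
  define s where "s x = (SOME s. s \<in> between (S_of k I) (n ^ k) ((n + 1) ^ k) \<and>
      (\<exists>a\<ge>1. real s = (real a * x) ^ k))" for x
  have s: "s x \<in> between (S_of k I) (n ^ k) ((n + 1) ^ k) \<and> (\<exists>a\<ge>1. real (s x) = (real a * x) ^ k)"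
    if x: "x \<in> I" "hit x n" for x
    unfolding s_def
  proof (rule someI_ex)
    obtain a where a: "real n < real a * x" "real a * x < real (n + 1)" using x by (auto simp: hit_def)
    have "a \<ge> 1" using a(1) by (cases a) auto
    thus "\<exists>s. s \<in> between (S_of k I) (n ^ k) ((n + 1) ^ k) \<and> (\<exists>a\<ge>1. real s = (real a * x) ^ k)"
      using S_ofI[OF x(1) I a] by metis
  qed
  have powD: "real a * x = real b * y" if "x \<in> I" "y \<in> I" "(real a * x) ^ k = (real b * y) ^ k" for a b x y
  proof (rule power_eq_imp_eq_base[OF that(3)])
    have "x > 2" "y > 2" using that I Lambda_gt_2[OF k2] by auto
    thus "0 \<le> real a * x" "0 \<le> real b * y" by auto
    show "0 < k" using k2 by simp
  qed
  have "bij_betw s {x\<in>I. hit x n} (between (S_of k I) (n ^ k) ((n + 1) ^ k))"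
    unfolding bij_betw_def
  proof (intro conjI inj_onI equalityI subsetI)
    fix x y assume x: "x \<in> {x\<in>I. hit x n}" and y: "y \<in> {x\<in>I. hit x n}" and eq: "s x = s y"
    obtain a where a: "a \<ge> 1" "real (s x) = (real a * x) ^ k" using s x by blast
    obtain b where b: "b \<ge> 1" "real (s y) = (real b * y) ^ k" using s y by blast
    have "real a * x = real b * y" using powD a b x y eq by auto
    thus "x = y" using Lambda_multiple_unique a b x y I by blast
  next
    fix t assume "t \<in> s ` {x\<in>I. hit x n}"
    thus "t \<in> between (S_of k I) (n ^ k) ((n + 1) ^ k)" using s by blast
  next
    fix t assume t: "t \<in> between (S_of k I) (n ^ k) ((n + 1) ^ k)"
    obtain a x where ax: "a \<ge> 1" "x \<in> I" "real t = (real a * x) ^ k" "real n < real a * x"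
      "real a * x < real (n + 1)" using S_ofE[OF t I] by metis
    have h: "hit x n" using ax by (auto simp: hit_def)
    obtain b y where by': "b \<ge> 1" "y \<in> I" "real (s x) = (real b * y) ^ k" "real n < real b * y"
      "real b * y < real (n + 1)" using S_ofE[OF conjunct1[OF s[OF ax(2) h]] I] by metis
    obtain c where c: "c \<ge> 1" "real (s x) = (real c * x) ^ k" using s[OF ax(2) h] by blast
    have "real b * y = real c * x" using powD by'(2,3) c(2) ax(2) by auto
    hence cx: "real n < real c * x" "real c * x < real n + 1" using by' by auto
    have x2: "x > 2" using ax(2) I Lambda_gt_2[OF k2] by blast
    have "a = c"
    proof (rule ccontr)
      assume "a \<noteq> c"
      hence "\<bar>real a - real c\<bar> \<ge> 1" by linarith
      hence "1 * x \<le> \<bar>real a - real c\<bar> * x" using x2 by (intro mult_right_mono) auto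
      also have "\<dots> = \<bar>real a * x - real c * x\<bar>" using x2 by (simp add: abs_mult left_diff_distrib[symmetric])
      also have "\<dots> < 1" using ax cx by auto
      finally show False using x2 by simp
    qed
    hence "real t = real (s x)" using ax(3) c(2) by simp
    thus "t \<in> s ` {x\<in>I. hit x n}" using ax(2) h by auto
  qed
  thus ?thesis by (simp add: bij_betw_same_card)
qed

text \<open>The interval of length 2 is covered by its two open halves because the midpoint
  \<open>n + 1\<close> is not a multiple of an irrational \<open>x\<close>.\<close>

lemma between_S_of_empty_iff:
  assumes I: "I \<subseteq> Lambda_set k"
  shows "between (S_of k I) (n ^ k) ((n + 2) ^ k) = {} \<longleftrightarrow> (\<forall>x\<in>I. \<not> hit x n \<and> \<not> hit x (n + 1))"
proof
  assume e: "between (S_of k I) (n ^ k) ((n + 2) ^ k) = {}"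
  show "\<forall>x\<in>I. \<not> hit x n \<and> \<not> hit x (n + 1)"
  proof (rule ccontr)
    assume "\<not> (\<forall>x\<in>I. \<not> hit x n \<and> \<not> hit x (n + 1))"
    then obtain x a where "x \<in> I" "real n < real a * x" "real a * x < real (n + 2)"
      by (fastforce simp: hit_def)
    thus False using S_ofI[OF _ I] e by blast
  qed
next
  assume h: "\<forall>x\<in>I. \<not> hit x n \<and> \<not> hit x (n + 1)"
  show "between (S_of k I) (n ^ k) ((n + 2) ^ k) = {}"
  proof (rule ccontr)
    assume "between (S_of k I) (n ^ k) ((n + 2) ^ k) \<noteq> {}"
    then obtain s where "s \<in> between (S_of k I) (n ^ k) ((n + 2) ^ k)" by blast
    then obtain a x where ax: "a \<ge> 1" "x \<in> I" "real n < real a * x" "real a * x < real (n + 2)"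
      using S_ofE[OF _ I] by metis
    have "x \<notin> \<rat>" using Lambda_irrational[OF k2] ax(2) I by blast
    moreover have "x = real (n + 1) / real a" if "real a * x = real (n + 1)"
      using that ax(1) by (simp add: field_simps)
    ultimately have "real a * x \<noteq> real (n + 1)" by (metis Rats_divide Rats_of_nat)
    hence "real a * x < real n + 1 \<or> real (n + 1) < real a * x \<and> real a * x < real (n + 1) + 1"
      using ax(4) by auto
    hence "hit x n \<or> hit x (n + 1)" using ax(3) unfolding hit_def by blast
    thus False using h ax(2) by blast
  qed
qed

lemma S_set_eq_S_of: "S_set k = S_of k (Lambda_set k)"
proof (intro equalityI subsetI)
  fix n assume "n \<in> S_set k"
  then obtain a N where aN: "n = a ^ k * N" "a \<ge> 1" "reduced_full k N" "N \<ge> 2"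
    unfolding S_set_eq[OF k2] by blast
  have "root k (real N) \<in> Lambda_set k" unfolding Lambda_set_eq[OF k2] using aN by blast
  moreover have "real n = real a ^ k * root k (real N) ^ k" using aN k2 by simp
  ultimately show "n \<in> S_of k (Lambda_set k)" unfolding S_of_def using aN(2) by blast
next
  fix n assume "n \<in> S_of k (Lambda_set k)"
  then obtain a x where ax: "a \<ge> 1" "x \<in> Lambda_set k" "real n = real a ^ k * x ^ k"
    unfolding S_of_def by blast
  obtain N where N: "reduced_full k N" "N \<ge> 2" "x ^ k = real N" using ax(2) by (rule LambdaE[OF k2])
  have "real n = real (a ^ k * N)" using ax N by simp
  hence "n = a ^ k * N" by (simp only: of_nat_eq_iff)
  thus "n \<in> S_set k" unfolding S_set_eq[OF k2] using ax N by blast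
qed

lemma A_set_eq: "A_set k l m = {n. n \<ge> 1 \<and> card (hits k n) = l \<and> card (hits k (n + 1)) = m}"
proof -
  have "card (between (S_set k) (n ^ k) ((n + 1) ^ k)) = card (hits k n)" for n
    unfolding S_set_eq_S_of hits_def by (rule card_between_S_of) simp
  note this[of n for n] this[of "n + 1" for n]
  thus ?thesis unfolding A_set_def by (simp add: numeral_2_eq_2)
qed

text \<open>Full cardinality means that every element of the finite set hits its window. Equality
  with the hit sets follows because a radical in \<open>I\<close> cannot also hit the second window,
  nor one in \<open>J\<close> the first.\<close>

lemma B_set_eq:
  assumes IJ: "I \<subseteq> Lambda_set k" "J \<subseteq> Lambda_set k" "finite I" "finite J" "I \<inter> J = {}"
  shows "B_set k I J = {n. n \<ge> 1 \<and> hits k n = I \<and> hits k (n + 1) = J}"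
proof -
  have c1: "card (between (S_of k I) (n ^ k) ((n + 1) ^ k)) = card I \<longleftrightarrow> (\<forall>x\<in>I. hit x n)" for n
  proof -
    have "card {x\<in>I. hit x n} = card I \<longleftrightarrow> {x\<in>I. hit x n} = I"
      using card_subset_eq[OF IJ(3), of "{x\<in>I. hit x n}"] by auto
    thus ?thesis using card_between_S_of[OF IJ(1), of n] by auto
  qed
  have c2: "card (between (S_of k J) ((n + 1) ^ k) ((n + 2) ^ k)) = card J \<longleftrightarrow> (\<forall>x\<in>J. hit x (n + 1))" for n
  proof -
    have "card {x\<in>J. hit x (n + 1)} = card J \<longleftrightarrow> {x\<in>J. hit x (n + 1)} = J"
      using card_subset_eq[OF IJ(4), of "{x\<in>J. hit x (n + 1)}"] by auto
    thus ?thesis using card_between_S_of[OF IJ(2), of "n + 1"] by (auto simp: numeral_2_eq_2)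
  qed
  have c3: "between (S_of k (Lambda_set k - (I \<union> J))) (n ^ k) ((n + 2) ^ k) = {} \<longleftrightarrow>
      (\<forall>x\<in>Lambda_set k - (I \<union> J). \<not> hit x n \<and> \<not> hit x (n + 1))" for n
    by (rule between_S_of_empty_iff) auto
  have "(\<forall>x\<in>I. hit x n) \<and> (\<forall>x\<in>J. hit x (n + 1)) \<and>
      (\<forall>x\<in>Lambda_set k - (I \<union> J). \<not> hit x n \<and> \<not> hit x (n + 1)) \<longleftrightarrow>
      hits k n = I \<and> hits k (n + 1) = J" for n
    using IJ(1,2,5) hits_disjoint[of n] unfolding hits_def by blast
  thus ?thesis unfolding B_set_def c1 c2 c3 by blast
qed


text \<open>
  The outcomes 0, 1, 2 mean that \<open>(n, n+2)\<close> contains no multiple of \<open>x\<close>, one in \<open>(n, n+1)\<close>, or one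
  in \<open>(n+1, n+2)\<close>. Outcome \<open>i\<close> forces \<open>n / x + outcome_shift x i\<close> into the arc of length
  \<open>outcome_vol x i\<close> centred at \<open>1/2\<close> modulo 1.
\<close>
definition outcome :: "real \<Rightarrow> nat \<Rightarrow> nat" where
  "outcome x n = (if hit x n then 1 else if hit x (n + 1) then 2 else 0)"

definition outcome_vol :: "real \<Rightarrow> nat \<Rightarrow> real" where
  "outcome_vol x i = (if i = 0 then 1 - 2 / x else 1 / x)"

definition outcome_shift :: "real \<Rightarrow> nat \<Rightarrow> real" where
  "outcome_shift x i = 1 / 2 + (if i = 0 then 1 / 2 + 1 / x else if i = 1 then 1 / (2 * x) else 3 / (2 * x))"

text \<open>For a suitable integer \<open>a\<close>, \<open>n / x\<close> lies in
  \<open>(a - 1 / x, a)\<close>, in \<open>(a - 2 / x, a - 1 / x)\<close> or in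
  \<open>(a - 1, a - 2 / x]\<close>. Apart from the common 1/2, the shifts are \<open>a\<close>
  minus the midpoints of these intervals.\<close>

lemma outcome_arc:
  assumes x: "x \<in> Lambda_set k" and n: "n \<ge> 1"
  shows "\<exists>m::int. \<bar>real n * (1 / x) + outcome_shift x (outcome x n) - 1/2 - of_int m\<bar> \<le> outcome_vol x (outcome x n) / 2"
proof -
  have x2: "x > 2" using Lambda_gt_2[OF k2 x] .
  consider "hit x n" | "\<not> hit x n" "hit x (n + 1)" | "\<not> hit x n" "\<not> hit x (n + 1)" by blast
  thus ?thesis
  proof cases
    case 1
    then obtain a :: nat where a: "real n < real a * x" "real a * x < real n + 1" by (auto simp: hit_def)
    have "real n / x < real a" "real a < real n / x + 1 / x" using a x2 by (simp_all add: field_simps)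
    hence "\<bar>real n / x + 1 / (2 * x) - real a\<bar> \<le> 1 / (2 * x)" by (simp add: abs_le_iff field_simps)
    thus ?thesis using 1 by (intro exI[of _ "int a"]) (simp add: outcome_def outcome_vol_def outcome_shift_def)
  next
    case 2
    then obtain a :: nat where a: "real n + 1 < real a * x" "real a * x < real n + 2"
      by (auto simp: hit_def add.commute)
    have "real n / x + 1 / x < real a" "real a < real n / x + 2 / x" using a x2 by (simp_all add: field_simps)
    hence "\<bar>real n / x + 3 / (2 * x) - real a\<bar> \<le> 1 / (2 * x)" by (simp add: abs_le_iff field_simps)
    thus ?thesis using 2 by (intro exI[of _ "int a"]) (simp add: outcome_def outcome_vol_def outcome_shift_def)
  next
    case 3
    \<comment> \<open>The first multiple of \<open>x\<close> from \<open>n\<close> on. It is never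
      an integer, and missing both windows pushes it past \<open>n + 1\<close> and then to at least
      \<open>n + 2\<close>.\<close>
    define a where "a = nat \<lceil>real n / x\<rceil>"
    have "real n / x > 0" using n x2 by simp
    hence "\<lceil>real n / x\<rceil> > 0" by simp
    hence a: "real n / x \<le> real a" "real a < real n / x + 1" "a \<ge> 1" unfolding a_def by linarith+
    have irr: "real a * x \<noteq> real m" for m :: nat
    proof
      assume "real a * x = real m"
      hence "x = real m / real a" using a(3) by (simp add: field_simps)
      thus False using Lambda_irrational[OF k2 x] by simp
    qed
    have "real n \<le> real a * x" using a(1) x2 by (simp add: field_simps)
    hence "real n < real a * x" using irr[of n] by simp
    hence "real n + 1 \<le> real a * x" using 3(1) by (force simp: hit_def)
    hence "real (n + 1) < real a * x" using irr[of "n + 1"] by simp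
    hence "real (n + 1) + 1 \<le> real a * x" using 3(2) by (force simp: hit_def)
    hence "real n / x + 2 / x \<le> real a" using x2 by (simp add: field_simps)
    moreover have "\<bar>p + (1 / 2 + q) - c\<bar> \<le> (1 - 2 * q) / 2" if "p + 2 * q \<le> c" "c < p + 1" for p q c :: real
      using that by (intro abs_leI) (simp_all add: diff_divide_distrib)
    from this[of "real n / x" "1 / x" "real a"]
    have "real n / x + 2 / x \<le> real a \<Longrightarrow> \<bar>real n / x + (1 / 2 + 1 / x) - real a\<bar> \<le> (1 - 2 / x) / 2"
      using a(2) by simp
    ultimately have "\<bar>real n / x + (1 / 2 + 1 / x) - real a\<bar> \<le> (1 - 2 / x) / 2" by blast
    thus ?thesis using 3
      by (intro exI[of _ "int a"]) (simp add: outcome_def outcome_vol_def outcome_shift_def add_ac)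
  qed
qed

text \<open>Since \<open>(1 - 2 / x) + 1 / x + 1 / x = 1\<close>, the volumes of all choices of
  outcomes on \<open>F\<close> add up to 1, so \<open>partition_density\<close> upgrades the upper
  bounds of \<open>weyl_upper_bound\<close> to limits.\<close>

lemma outcome_density:
  assumes F: "finite F" "F \<subseteq> Lambda_set k" and u: "u \<in> F \<rightarrow>\<^sub>E {0, 1, 2}"
  shows "(\<lambda>N. real (card {n\<in>{1..N}. n \<in> {n. \<forall>x\<in>F. outcome x n = u x}}) / real N)
           \<longlonglongrightarrow> (\<Prod>x\<in>F. outcome_vol x (u x))"
proof (rule partition_density[where U = "F \<rightarrow>\<^sub>E {0, 1, 2}" and u = u and
      S = "\<lambda>u. {n. \<forall>x\<in>F. outcome x n = u x}" and v = "\<lambda>u. \<Prod>x\<in>F. outcome_vol x (u x)", OF _ _ _ _ u])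
  have x2: "x > 2" if "x \<in> F" for x using that F Lambda_gt_2[OF k2] by blast
  have vol: "0 \<le> outcome_vol x i" "outcome_vol x i < 1" if "x \<in> F" for x i
    using x2[OF that] by (auto simp: outcome_vol_def field_simps)
  show "finite (F \<rightarrow>\<^sub>E {0::nat, 1, 2})" using F by (intro finite_PiE) auto
  have "(\<Sum>u\<in>F \<rightarrow>\<^sub>E {0, 1, 2}. \<Prod>x\<in>F. outcome_vol x (u x)) = (\<Prod>x\<in>F. \<Sum>i\<in>{0, 1, 2}. outcome_vol x i)"
    using F by (intro prod_sum_PiE[symmetric]) auto
  also have "\<dots> = 1" by (intro prod.neutral) (simp add: outcome_vol_def)
  finally show "(\<Sum>u\<in>F \<rightarrow>\<^sub>E {0, 1, 2}. \<Prod>x\<in>F. outcome_vol x (u x)) = 1" .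
  show "\<exists>u\<in>F \<rightarrow>\<^sub>E {0, 1, 2}. n \<in> {n. \<forall>x\<in>F. outcome x n = u x}" for n
    by (intro bexI[of _ "\<lambda>x\<in>F. outcome x n"]) (auto simp: outcome_def)
  fix u :: "real \<Rightarrow> nat" and \<epsilon> :: real
  assume "\<epsilon> > 0"
  hence "\<forall>\<^sub>F N in sequentially. real (card {n\<in>{1..N}. \<forall>x\<in>F. \<exists>m::int.
      \<bar>real n * (1 / x) + outcome_shift x (u x) - 1/2 - of_int m\<bar> \<le> outcome_vol x (u x) / 2})
        \<le> ((\<Prod>x\<in>F. 2 * (outcome_vol x (u x) / 2)) + \<epsilon>) * real N"
    using F x2 vol by (intro weyl_upper_bound Lambda_inverses_independent[OF k2]) auto
  thus "\<forall>\<^sub>F N in sequentially. real (card {n\<in>{1..N}. n \<in> {n. \<forall>x\<in>F. outcome x n = u x}})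
      \<le> ((\<Prod>x\<in>F. outcome_vol x (u x)) + \<epsilon>) * real N"
  proof eventually_elim
    case (elim N)
    have "card {n\<in>{1..N}. n \<in> {n. \<forall>x\<in>F. outcome x n = u x}} \<le> card {n\<in>{1..N}. \<forall>x\<in>F. \<exists>m::int.
      \<bar>real n * (1 / x) + outcome_shift x (u x) - 1/2 - of_int m\<bar> \<le> outcome_vol x (u x) / 2}"
    proof (intro card_mono subsetI CollectI conjI ballI)
      fix n x assume n: "n \<in> {n\<in>{1..N}. n \<in> {n. \<forall>x\<in>F. outcome x n = u x}}" and x: "x \<in> F"
      hence "outcome x n = u x" "n \<ge> 1" "x \<in> Lambda_set k" using F by auto
      thus "\<exists>m::int. \<bar>real n * (1 / x) + outcome_shift x (u x) - 1/2 - of_int m\<bar> \<le> outcome_vol x (u x) / 2"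
        using outcome_arc[of x n] by simp
    qed auto
    thus ?case using elim by simp
  qed
qed

lemma finite_hits_density:
  assumes F: "finite F" "F \<subseteq> Lambda_set k" and IJ: "I \<subseteq> F" "J \<subseteq> F" "I \<inter> J = {}"
  shows "(\<lambda>N. real (card {n\<in>{1..N}. hits k n \<inter> F = I \<and> hits k (n + 1) \<inter> F = J}) / real N)
    \<longlonglongrightarrow> (\<Prod>x\<in>I \<union> J. 1 / x) * (\<Prod>x\<in>F - (I \<union> J). 1 - 2 / x)"
proof -
  define u where "u = (\<lambda>x\<in>F. if x \<in> I then 1 else if x \<in> J then 2 else (0::nat))"
  have uP: "u \<in> F \<rightarrow>\<^sub>E {0, 1, 2}" by (auto simp: u_def)
  have "(\<Prod>x\<in>F. outcome_vol x (u x)) =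
      (\<Prod>x\<in>F - (I \<union> J). outcome_vol x (u x)) * (\<Prod>x\<in>I \<union> J. outcome_vol x (u x))"
    using F IJ by (intro prod.subset_diff) auto
  also have "(\<Prod>x\<in>F - (I \<union> J). outcome_vol x (u x)) = (\<Prod>x\<in>F - (I \<union> J). 1 - 2 / x)"
    by (intro prod.cong refl) (auto simp: u_def outcome_vol_def)
  also have "(\<Prod>x\<in>I \<union> J. outcome_vol x (u x)) = (\<Prod>x\<in>I \<union> J. 1 / x)"
    using IJ by (intro prod.cong refl) (auto simp: u_def outcome_vol_def)
  finally have vol: "(\<Prod>x\<in>F. outcome_vol x (u x)) = (\<Prod>x\<in>I \<union> J. 1 / x) * (\<Prod>x\<in>F - (I \<union> J). 1 - 2 / x)"
    by (simp only: mult.commute)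
  have "n \<in> {n. \<forall>x\<in>F. outcome x n = u x} \<longleftrightarrow> hits k n \<inter> F = I \<and> hits k (n + 1) \<inter> F = J" for n
  proof -
    have eq: "outcome x n = u x \<longleftrightarrow> (hit x n \<longleftrightarrow> x \<in> I) \<and> (hit x (n + 1) \<longleftrightarrow> x \<in> J)" if "x \<in> F" for x
    proof -
      have "\<not> (hit x n \<and> hit x (n + 1))"
        using that F hit_exclusive Lambda_gt_2[OF k2] by blast
      moreover have "\<not> (x \<in> I \<and> x \<in> J)" using IJ by blast
      ultimately show ?thesis using that by (auto simp: outcome_def u_def)
    qed
    have "hits k n \<inter> F = I \<and> hits k (n + 1) \<inter> F = J \<longleftrightarrow>
        (\<forall>x\<in>F. (hit x n \<longleftrightarrow> x \<in> I) \<and> (hit x (n + 1) \<longleftrightarrow> x \<in> J))"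
      using F(2) IJ(1,2) unfolding hits_def by blast
    thus ?thesis using eq by simp
  qed
  thus ?thesis using outcome_density[OF F uP] unfolding vol by simp
qed

text \<open>The partial products decrease, so they converge to their infimum; only then is the
  \<open>Lim\<close> in \<open>set_prod_lim\<close> known to be a limit. Positivity uses that a
  product of factors \<open>1 - 2 / x\<close> is at least 1 minus the sum of the
  \<open>2 / x\<close>.\<close>

lemma prod_tendsto_set_prod_lim:
  assumes A: "A \<subseteq> Lambda_set k"
  shows "((\<lambda>M. \<Prod>x | x \<in> A \<and> x \<le> M. 1 - 2 / x) \<longlongrightarrow> set_prod_lim (\<lambda>x. 1 - 2 / x) A) at_top"
    and "set_prod_lim (\<lambda>x. 1 - 2 / x) A > 0"
proof -
  define p where "p M = (\<Prod>x | x \<in> A \<and> x \<le> M. 1 - 2 / x)" for M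
  have x2: "x > 2" if "x \<in> A" for x using that A Lambda_gt_2[OF k2] by blast
  have fin: "finite {x. x \<in> A \<and> x \<le> M}" for M
    by (rule finite_subset[OF _ finite_Lambda_le[of M]]) (use A in auto)
  have fac: "0 < 1 - 2 / x" "1 - 2 / x \<le> 1" if "x \<in> A" for x using x2[OF that] by auto
  have ppos: "p M > 0" for M unfolding p_def using fac by (intro prod_pos) auto
  have split: "p M' = p M * (\<Prod>x | x \<in> A \<and> M < x \<and> x \<le> M'. 1 - 2 / x)" if "M \<le> M'" for M M'
  proof -
    have "{x. x \<in> A \<and> x \<le> M'} = {x. x \<in> A \<and> x \<le> M} \<union> {x. x \<in> A \<and> M < x \<and> x \<le> M'}" using that by auto
    thus ?thesis unfolding p_def using fin[of M] fin[of M']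
      by (simp add: prod.union_disjoint disjoint_iff)
  qed
  have anti: "p M' \<le> p M" if "M \<le> M'" for M M'
  proof -
    have "(\<Prod>x | x \<in> A \<and> M < x \<and> x \<le> M'. 1 - 2 / x) \<le> 1"
      using fac by (intro prod_le_1) (auto intro: less_imp_le)
    thus ?thesis unfolding split[OF that] using ppos[of M] by (simp add: mult_le_cancel_left1)
  qed
  define L where "L = (INF M. p M)"
  have bdd: "bdd_below (range p)" using ppos by (intro bdd_belowI[of _ 0]) (auto intro: less_imp_le)
  have lim: "(p \<longlongrightarrow> L) at_top"
  proof (rule order_tendstoI)
    fix a assume "a < L"
    hence "a < p M" for M unfolding L_def using cINF_lower[OF bdd, of M] by fastforce
    thus "\<forall>\<^sub>F M in at_top. a < p M" by simp
  next
    fix a assume "L < a"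
    then obtain M where M: "p M < a" unfolding L_def using bdd by (subst (asm) cINF_less_iff) auto
    show "\<forall>\<^sub>F M in at_top. p M < a"
      using eventually_ge_at_top[of M] by eventually_elim (use anti M in \<open>fastforce intro: le_less_trans\<close>)
  qed
  hence Leq: "set_prod_lim (\<lambda>x. 1 - 2 / x) A = L"
    unfolding set_prod_lim_def p_def by (intro tendsto_Lim) auto
  show "((\<lambda>M. \<Prod>x | x \<in> A \<and> x \<le> M. 1 - 2 / x) \<longlongrightarrow> set_prod_lim (\<lambda>x. 1 - 2 / x) A) at_top"
    using lim unfolding Leq p_def .
  \<comment> \<open>A tail below 1/4 keeps the sum of \<open>2 / x\<close> beyond \<open>M\<close>
    at most 1/2, so the later factors reduce the product at most by half.\<close>
  have "\<forall>\<^sub>F M in at_top. tail M < 1 / 4" using tail_tendsto_0 by (rule order_tendstoD) simp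
  then obtain M where M: "tail M < 1 / 4"
    using eventually_happens'[OF trivial_limit_at_top_linorder] by blast
  have "p M * (1 / 2) \<le> p M'" if "M \<le> M'" for M'
  proof -
    let ?X = "{x. x \<in> A \<and> M < x \<and> x \<le> M'}"
    have finX: "finite ?X" by (rule finite_subset[OF _ fin[of M']]) auto
    have "(\<Sum>x\<in>?X. 1 / x) \<le> tail M"
      unfolding tail_def using A
      by (intro finite_sum_le_infsum[OF tail_summable finX]) (auto intro: Lambda_nonneg[OF k2])
    hence "(\<Sum>x\<in>?X. 2 / x) \<le> 1 / 2" 
    proof -
      have "(\<Sum>x\<in>?X. 2 / x) = 2 * (\<Sum>x\<in>?X. 1 / x)" by (simp add: sum_distrib_left)
      thus ?thesis using M \<open>(\<Sum>x\<in>?X. 1 / x) \<le> tail M\<close> by linarith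
    qed
    moreover have "1 - (\<Sum>x\<in>?X. 2 / x) \<le> (\<Prod>x\<in>?X. 1 - 2 / x)"
      using x2 by (intro Weierstrass_prod_ineq) force
    ultimately have "1 / 2 \<le> (\<Prod>x\<in>?X. 1 - 2 / x)" by linarith
    thus ?thesis unfolding split[OF that] using ppos[of M] by (intro mult_left_mono) auto
  qed
  hence "\<forall>\<^sub>F M' in at_top. p M * (1 / 2) \<le> p M'" 
    by (rule eventually_mono[OF eventually_ge_at_top[of M]])
  hence "p M * (1 / 2) \<le> L" using lim by (intro tendsto_lowerbound[of p L at_top]) auto
  thus "set_prod_lim (\<lambda>x. 1 - 2 / x) A > 0" unfolding Leq using ppos[of M] by linarith
qed

lemma dens_term_pos:
  assumes "I \<subseteq> Lambda_set k" "J \<subseteq> Lambda_set k"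
  shows "dens_term k I J > 0"
  unfolding dens_term_def using prod_tendsto_set_prod_lim(2)[of "Lambda_set k - (I \<union> J)"] assms
  by (intro mult_pos_pos prod_pos) (auto dest!: Lambda_gt_2[OF k2] subsetD)

text \<open>The common truncation estimate, used to compare \<open>B_set\<close> with its version
  for \<open>x \<le> M\<close>, and \<open>A_set\<close> with the union of the \<open>B_set\<close>
  whose index sets lie below \<open>M\<close>.\<close>

lemma abs_count_diff_le:
  assumes N: "N \<ge> 1" and BE: "{n\<in>{1..N}. n \<in> B} \<subseteq> {n\<in>{1..N}. n \<in> E}"
    and ER: "\<And>n. n \<ge> 1 \<Longrightarrow> n \<in> E \<Longrightarrow> n \<notin> B \<Longrightarrow> \<exists>x\<in>Lambda_set k. x > M \<and> (hit x n \<or> hit x (n + 1))"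
  shows "\<bar>real (card {n\<in>{1..N}. n \<in> B}) / real N - real (card {n\<in>{1..N}. n \<in> E}) / real N\<bar> \<le> 6 * tail M"
proof -
  let ?R = "{n\<in>{1..N}. \<exists>x\<in>Lambda_set k. x > M \<and> (hit x n \<or> hit x (n + 1))}"
  have "card {n\<in>{1..N}. n \<in> E} \<le> card ({n\<in>{1..N}. n \<in> B} \<union> ?R)"
    using ER by (intro card_mono) auto
  also have "\<dots> \<le> card {n\<in>{1..N}. n \<in> B} + card ?R" by (rule card_Un_le)
  finally have 1: "real (card {n\<in>{1..N}. n \<in> E}) \<le> real (card {n\<in>{1..N}. n \<in> B}) + real (card ?R)"
    by linarith
  have 2: "card {n\<in>{1..N}. n \<in> B} \<le> card {n\<in>{1..N}. n \<in> E}" using BE by (intro card_mono) auto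
  have "real (card ?R) \<le> 2 * (real N + 2) * tail M" by (rule card_tail_hits_le)
  \<comment> \<open>Here \<open>2 * (N + 2) \<le> 6 * N\<close> because \<open>N \<ge> 1\<close>;
    after division by \<open>N\<close> the error no longer depends on it.\<close>
  also have "\<dots> \<le> 6 * real N * tail M" using N tail_nonneg by (intro mult_right_mono) auto
  finally have "real (card {n\<in>{1..N}. n \<in> E}) \<le> real (card {n\<in>{1..N}. n \<in> B}) + 6 * real N * tail M"
    using 1 by linarith
  thus ?thesis using N 2 by (simp add: abs_le_iff field_simps)
qed

text \<open>\<open>E M\<close> ignores the radicals above \<open>M\<close>, so finite independence
  gives its density; the error tends to 0 with \<open>tail M\<close>, and the finite products
  converge to \<open>dens_term\<close>.\<close>

lemma B_set_tendsto:
  assumes IJ: "(I, J) \<in> index_set k l m"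
  shows "(\<lambda>N. real (card {n\<in>{1..N}. n \<in> B_set k I J}) / real N) \<longlonglongrightarrow> dens_term k I J"
proof -
  have IJ': "I \<subseteq> Lambda_set k" "J \<subseteq> Lambda_set k" "finite I" "finite J" "I \<inter> J = {}"
    using IJ by (auto simp: index_set_def)
  define \<Lambda> where "\<Lambda> M = {x\<in>Lambda_set k. x \<le> M}" for M
  define E where "E M = {n. hits k n \<inter> \<Lambda> M = I \<and> hits k (n + 1) \<inter> \<Lambda> M = J}" for M
  \<comment> \<open>Below this threshold the condition defining \<open>E M\<close> could not hold,
    as some required radical would be cut off.\<close>
  have "\<forall>\<^sub>F M in at_top. \<forall>x\<in>I \<union> J. x \<le> M"
    using IJ' by (auto simp: eventually_ball_finite_distrib eventually_ge_at_top)
  hence ev: "\<forall>\<^sub>F M in at_top. I \<subseteq> \<Lambda> M \<and> J \<subseteq> \<Lambda> M"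
    by eventually_elim (use IJ' in \<open>auto simp: \<Lambda>_def\<close>)
  show ?thesis
  proof (rule tendsto_uniform_approx[where \<tau> = "\<lambda>M. 6 * tail M" and
        g = "\<lambda>M N. real (card {n\<in>{1..N}. n \<in> E M}) / real N" and
        d = "\<lambda>M. (\<Prod>x\<in>I \<union> J. 1 / x) * (\<Prod>x\<in>\<Lambda> M - (I \<union> J). 1 - 2 / x)"])
    show "\<forall>\<^sub>F M in at_top. (\<lambda>N. real (card {n\<in>{1..N}. n \<in> E M}) / real N) \<longlonglongrightarrow>
        (\<Prod>x\<in>I \<union> J. 1 / x) * (\<Prod>x\<in>\<Lambda> M - (I \<union> J). 1 - 2 / x)"
      using ev
    proof eventually_elim
      case (elim M)
      show ?case unfolding E_def mem_Collect_eq
        by (rule finite_hits_density) (use elim IJ' finite_Lambda_le in \<open>auto simp: \<Lambda>_def\<close>)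
    qed
    show "\<forall>\<^sub>F M in at_top. \<forall>N\<ge>1. \<bar>real (card {n\<in>{1..N}. n \<in> B_set k I J}) / real N -
        real (card {n\<in>{1..N}. n \<in> E M}) / real N\<bar> \<le> 6 * tail M"
      using ev
    proof eventually_elim
      case (elim M)
      show ?case
      proof (intro allI impI abs_count_diff_le)
        show "{n\<in>{1..N}. n \<in> B_set k I J} \<subseteq> {n\<in>{1..N}. n \<in> E M}" for N
          unfolding B_set_eq[OF IJ'] E_def using elim by auto
        fix N n :: nat assume n: "n \<ge> 1" "n \<in> E M" "n \<notin> B_set k I J"
        have E: "hits k n \<inter> \<Lambda> M = I" "hits k (n + 1) \<inter> \<Lambda> M = J" using n(2) by (auto simp: E_def)
        have "hits k n \<noteq> I \<or> hits k (n + 1) \<noteq> J" using n(1,3) unfolding B_set_eq[OF IJ'] by blast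
        hence "\<exists>x\<in>hits k n \<union> hits k (n + 1). x \<notin> \<Lambda> M" using E by blast
        thus "\<exists>x\<in>Lambda_set k. M < x \<and> (hit x n \<or> hit x (n + 1))"
          unfolding \<Lambda>_def hits_def by force
      qed
    qed
    have "{x. x \<in> Lambda_set k - (I \<union> J) \<and> x \<le> M} = \<Lambda> M - (I \<union> J)" for M by (auto simp: \<Lambda>_def)
    thus "((\<lambda>M. (\<Prod>x\<in>I \<union> J. 1 / x) * (\<Prod>x\<in>\<Lambda> M - (I \<union> J). 1 - 2 / x)) \<longlongrightarrow> dens_term k I J) at_top"
      unfolding dens_term_def using prod_tendsto_set_prod_lim(1)[of "Lambda_set k - (I \<union> J)"]
      by (intro tendsto_mult tendsto_const) auto
    show "((\<lambda>M. 6 * tail M) \<longlongrightarrow> 0) at_top"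
      using tendsto_mult_right_zero[OF tail_tendsto_0] by simp
  qed
qed


lemma B_set_disjoint:
  assumes "(I, J) \<in> index_set k l m" "(I', J') \<in> index_set k l m" "(I, J) \<noteq> (I', J')"
  shows "B_set k I J \<inter> B_set k I' J' = {}"
proof -
  have "B_set k I J = {n. n \<ge> 1 \<and> hits k n = I \<and> hits k (n + 1) = J}"
    by (rule B_set_eq) (use assms(1) in \<open>auto simp: index_set_def\<close>)
  moreover have "B_set k I' J' = {n. n \<ge> 1 \<and> hits k n = I' \<and> hits k (n + 1) = J'}"
    by (rule B_set_eq) (use assms(2) in \<open>auto simp: index_set_def\<close>)
  ultimately show ?thesis using assms(3) by auto
qed

lemma sum_card_B_set:
  assumes X: "finite X" "X \<subseteq> index_set k l m"
  shows "(\<Sum>(I, J)\<in>X. real (card {n\<in>{1..N}. n \<in> B_set k I J}) / real N) =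
    real (card {n\<in>{1..N}. n \<in> (\<Union>(I, J)\<in>X. B_set k I J)}) / real N"
proof -
  have "{n\<in>{1..N}. n \<in> (\<Union>(I, J)\<in>X. B_set k I J)} = (\<Union>t\<in>X. {n\<in>{1..N}. n \<in> B_set k (fst t) (snd t)})"
    by auto
  also have "card \<dots> = (\<Sum>t\<in>X. card {n\<in>{1..N}. n \<in> B_set k (fst t) (snd t)})"
  proof (intro card_UN_disjoint X ballI impI)
    fix s t assume "s \<in> X" "t \<in> X" "s \<noteq> t"
    hence "B_set k (fst s) (snd s) \<inter> B_set k (fst t) (snd t) = {}"
      using X by (intro B_set_disjoint) auto
    thus "{n\<in>{1..N}. n \<in> B_set k (fst s) (snd s)} \<inter> {n\<in>{1..N}. n \<in> B_set k (fst t) (snd t)} = {}" by blast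
  qed auto
  finally show ?thesis by (simp add: case_prod_unfold sum_divide_distrib)
qed

text \<open>A finite partial sum is the limit of relative counts of a disjoint union of sets
  \<open>B_set\<close>, and these counts are at most 1.\<close>

lemma dens_term_summable: "(\<lambda>(I, J). dens_term k I J) summable_on index_set k l m"
proof (rule nonneg_bdd_above_summable_on)
  show "(case t of (I, J) \<Rightarrow> dens_term k I J) \<ge> 0" if "t \<in> index_set k l m" for t
    using that dens_term_pos by (force simp: index_set_def intro: less_imp_le)
  have "(\<Sum>(I, J)\<in>X. dens_term k I J) \<le> 1" if X: "X \<subseteq> index_set k l m" "finite X" for X
  proof (rule tendsto_upperbound)
    show "(\<lambda>N. \<Sum>(I, J)\<in>X. real (card {n\<in>{1..N}. n \<in> B_set k I J}) / real N)
        \<longlonglongrightarrow> (\<Sum>(I, J)\<in>X. dens_term k I J)"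
      unfolding case_prod_unfold using X by (intro tendsto_sum B_set_tendsto[of _ _ l m]) auto
    show "\<forall>\<^sub>F N in sequentially. (\<Sum>(I, J)\<in>X. real (card {n\<in>{1..N}. n \<in> B_set k I J}) / real N) \<le> 1"
      unfolding sum_card_B_set[OF X(2,1)]
    proof (rule always_eventually, rule allI)
      fix N
      have "card {n\<in>{1..N}. n \<in> (\<Union>(I, J)\<in>X. B_set k I J)} \<le> card {1..N}" by (intro card_mono) auto
      thus "real (card {n\<in>{1..N}. n \<in> (\<Union>(I, J)\<in>X. B_set k I J)}) / real N \<le> 1"
        by (cases "N = 0") (simp_all add: divide_le_eq_1)
    qed
  qed simp
  thus "bdd_above (sum (\<lambda>(I, J). dens_term k I J) ` {X. X \<subseteq> index_set k l m \<and> finite X})"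
    by (intro bdd_aboveI[of _ 1]) auto
qed

lemma finite_index_le: "finite {(I, J)\<in>index_set k l m. I \<union> J \<subseteq> {..M}}"
  by (rule finite_subset[of _ "Pow {x\<in>Lambda_set k. x \<le> M} \<times> Pow {x\<in>Lambda_set k. x \<le> M}"])
     (auto simp: index_set_def finite_Lambda_le)

lemma filterlim_index_le:
  "filterlim (\<lambda>M. {(I, J)\<in>index_set k l m. I \<union> J \<subseteq> {..M}}) (finite_subsets_at_top (index_set k l m)) at_top"
  unfolding filterlim_finite_subsets_at_top
proof (intro allI impI)
  fix X assume X: "finite X \<and> X \<subseteq> index_set k l m"
  have "finite (\<Union>(I, J)\<in>X. I \<union> J)" using X by (auto simp: index_set_def)
  hence "\<forall>\<^sub>F M in at_top. \<forall>x\<in>(\<Union>(I, J)\<in>X. I \<union> J). x \<le> M"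
    by (simp only: eventually_ball_finite_distrib eventually_ge_at_top) simp
  thus "\<forall>\<^sub>F M in at_top. finite {(I, J)\<in>index_set k l m. I \<union> J \<subseteq> {..M}} \<and>
      X \<subseteq> {(I, J)\<in>index_set k l m. I \<union> J \<subseteq> {..M}} \<and>
      {(I, J)\<in>index_set k l m. I \<union> J \<subseteq> {..M}} \<subseteq> index_set k l m"
  proof eventually_elim
    case (elim M)
    have "X \<subseteq> {(I, J)\<in>index_set k l m. I \<union> J \<subseteq> {..M}}" using X elim by fastforce
    thus ?case using finite_index_le by auto
  qed
qed

text \<open>\<open>A_set\<close> is the disjoint union of all \<open>B_set\<close>. An element
  outside the finitely many with \<open>I\<close> and \<open>J\<close> below \<open>M\<close> is hit
  by some \<open>x > M\<close>, so the same tail estimate justifies termwise summation.\<close>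

lemma A_set_tendsto:
  "(\<lambda>N. real (card {n\<in>{1..N}. n \<in> A_set k l m}) / real N) \<longlonglongrightarrow>
    (\<Sum>\<^sub>\<infinity>(I, J)\<in>index_set k l m. dens_term k I J)"
proof -
  define X where "X M = {(I, J)\<in>index_set k l m. I \<union> J \<subseteq> {..M}}" for M
  have Xsub: "X M \<subseteq> index_set k l m" for M by (auto simp: X_def)
  have finX: "finite (X M)" for M unfolding X_def by (rule finite_index_le)
  have Beq: "B_set k I J = {n. n \<ge> 1 \<and> hits k n = I \<and> hits k (n + 1) = J}" if "(I, J) \<in> index_set k l m" for I J
    by (rule B_set_eq) (use that in \<open>auto simp: index_set_def\<close>)
  have Asub: "(\<Union>(I, J)\<in>X M. B_set k I J) \<subseteq> A_set k l m" for M
  proof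
    fix n assume "n \<in> (\<Union>(I, J)\<in>X M. B_set k I J)"
    then obtain I J where IJ: "(I, J) \<in> index_set k l m" "n \<in> B_set k I J" by (auto simp: X_def)
    thus "n \<in> A_set k l m" unfolding A_set_eq using Beq[OF IJ(1)] by (auto simp: index_set_def)
  qed
  show ?thesis
  proof (rule tendsto_uniform_approx[where \<tau> = "\<lambda>M. 6 * tail M" and
        g = "\<lambda>M N. \<Sum>(I, J)\<in>X M. real (card {n\<in>{1..N}. n \<in> B_set k I J}) / real N" and
        d = "\<lambda>M. \<Sum>(I, J)\<in>X M. dens_term k I J"])
    show "\<forall>\<^sub>F M in at_top. (\<lambda>N. \<Sum>(I, J)\<in>X M. real (card {n\<in>{1..N}. n \<in> B_set k I J}) / real N)
        \<longlonglongrightarrow> (\<Sum>(I, J)\<in>X M. dens_term k I J)"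
    proof (rule always_eventually, rule allI)
      fix M
      show "(\<lambda>N. \<Sum>(I, J)\<in>X M. real (card {n\<in>{1..N}. n \<in> B_set k I J}) / real N)
        \<longlonglongrightarrow> (\<Sum>(I, J)\<in>X M. dens_term k I J)"
        unfolding case_prod_unfold using Xsub[of M] by (intro tendsto_sum B_set_tendsto[of _ _ l m]) auto
    qed
    show "\<forall>\<^sub>F M in at_top. \<forall>N\<ge>1. \<bar>real (card {n\<in>{1..N}. n \<in> A_set k l m}) / real N -
        (\<Sum>(I, J)\<in>X M. real (card {n\<in>{1..N}. n \<in> B_set k I J}) / real N)\<bar> \<le> 6 * tail M"
    proof (rule always_eventually, intro allI impI)
      fix M and N :: nat assume N: "1 \<le> N"
      have "\<bar>real (card {n\<in>{1..N}. n \<in> (\<Union>(I, J)\<in>X M. B_set k I J)}) / real N -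
          real (card {n\<in>{1..N}. n \<in> A_set k l m}) / real N\<bar> \<le> 6 * tail M"
      proof (rule abs_count_diff_le[OF N])
        show "{n\<in>{1..N}. n \<in> (\<Union>(I, J)\<in>X M. B_set k I J)} \<subseteq> {n\<in>{1..N}. n \<in> A_set k l m}"
          using Asub[of M] by blast
        fix n assume n: "n \<ge> 1" "n \<in> A_set k l m" "n \<notin> (\<Union>(I, J)\<in>X M. B_set k I J)"
        \<comment> \<open>The index of \<open>n\<close> is its own pair of hit sets. Their
          finiteness is proved separately, since \<open>card\<close> is also 0 on infinite
          sets.\<close>
        have idx: "(hits k n, hits k (n + 1)) \<in> index_set k l m"
          using n(2) finite_hits hits_disjoint unfolding A_set_eq index_set_def
          by (auto simp: hits_def simp del: Suc_eq_plus1 add_Suc_right)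
        hence "n \<in> B_set k (hits k n) (hits k (n + 1))" using n(1) Beq by blast
        hence "(hits k n, hits k (n + 1)) \<notin> X M" using n(3) by auto
        hence "\<exists>x\<in>hits k n \<union> hits k (n + 1). \<not> x \<le> M" using idx by (auto simp: X_def)
        thus "\<exists>x\<in>Lambda_set k. M < x \<and> (hit x n \<or> hit x (n + 1))"
          unfolding hits_def by force
      qed
      thus "\<bar>real (card {n\<in>{1..N}. n \<in> A_set k l m}) / real N -
        (\<Sum>(I, J)\<in>X M. real (card {n\<in>{1..N}. n \<in> B_set k I J}) / real N)\<bar> \<le> 6 * tail M"
        unfolding sum_card_B_set[OF finX Xsub] by (subst abs_minus_commute)
    qed
    have "((\<lambda>(I, J). dens_term k I J) has_sum (\<Sum>\<^sub>\<infinity>(I, J)\<in>index_set k l m. dens_term k I J)) (index_set k l m)"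
      using dens_term_summable by (rule has_sum_infsum)
    thus "((\<lambda>M. \<Sum>(I, J)\<in>X M. dens_term k I J) \<longlongrightarrow> (\<Sum>\<^sub>\<infinity>(I, J)\<in>index_set k l m. dens_term k I J)) at_top"
      unfolding has_sum_def X_def by (rule filterlim_compose[OF _ filterlim_index_le])
    show "((\<lambda>M. 6 * tail M) \<longlongrightarrow> 0) at_top"
      using tendsto_mult_right_zero[OF tail_tendsto_0] by simp
  qed
qed

lemma index_set_nonempty: "index_set k l m \<noteq> {}"
proof -
  obtain I where I: "finite I" "card I = l" "I \<subseteq> Lambda_set k"
    using infinite_arbitrarily_large[OF infinite_Lambda[OF k2]] by blast
  have "infinite (Lambda_set k - I)" using infinite_Lambda[OF k2] I(1) by simp
  then obtain J where J: "finite J" "card J = m" "J \<subseteq> Lambda_set k - I"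
    using infinite_arbitrarily_large by blast
  hence "(I, J) \<in> index_set k l m" using I by (auto simp: index_set_def)
  thus ?thesis by blast
qed

lemma dens_sum_pos: "(\<Sum>\<^sub>\<infinity>(I, J)\<in>index_set k l m. dens_term k I J) > 0"
proof -
  obtain I J where IJ: "(I, J) \<in> index_set k l m" using index_set_nonempty[of l m] by auto
  have pos: "(case t of (I, J) \<Rightarrow> dens_term k I J) > 0" if "t \<in> index_set k l m" for t
    using that dens_term_pos by (auto simp: index_set_def)
  have "0 < (\<Sum>(I, J)\<in>{(I, J)}. dens_term k I J)" using pos[OF IJ] by simp
  also have "\<dots> \<le> (\<Sum>\<^sub>\<infinity>(I, J)\<in>index_set k l m. dens_term k I J)"
    using IJ pos by (intro finite_sum_le_infsum dens_term_summable) (auto intro: less_imp_le)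
  finally show ?thesis .
qed

end

theorem theorem2:
  fixes k l m :: nat
  assumes "k \<ge> 2"
  shows "\<exists>D. D > 0 \<and> has_density (A_set k l m) D \<and>
           ((\<lambda>(I, J). dens_term k I J) has_sum D) (index_set k l m) \<and>
           (\<forall>(I, J)\<in>index_set k l m. has_density (B_set k I J) (dens_term k I J))"
proof (intro exI[of _ "\<Sum>\<^sub>\<infinity>(I, J)\<in>index_set k l m. dens_term k I J"] conjI)
  show "has_density (A_set k l m) (\<Sum>\<^sub>\<infinity>(I, J)\<in>index_set k l m. dens_term k I J)"
    by (rule has_densityI[OF A_set_tendsto[OF assms]]) (simp add: A_set_def)
  have "has_density (B_set k I J) (dens_term k I J)" if "(I, J) \<in> index_set k l m" for I J
    by (rule has_densityI[OF B_set_tendsto[OF assms that]]) (simp add: B_set_def)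
  thus "\<forall>(I, J)\<in>index_set k l m. has_density (B_set k I J) (dens_term k I J)" by blast
qed (use dens_sum_pos[OF assms] dens_term_summable[OF assms] in \<open>auto intro: has_sum_infsum\<close>)

end
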